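(* Let $\mathcal{P}$ be an arbitrary nonempty family of nonempty subsets of $\{1,\dots,K\}$. Suppose that the thresholds of the G-SLRT $(\hat\tau,\hat d)$ are chosen as $b=|\log(\alpha/|\mathcal{P}|)|$ and $a=|\log\beta|$, where $\alpha,\beta\in(0,1)$. Suppose that for some $r\in\mathbb{N}$ there are positive and finite numbers $I_0^k,I_1^k$, $1\le k\le K$, such that for every $1\le k\le K$ and every $\varepsilon>0$ $$\sum_{t=1}^\infty t^{r-1}\,\mathsf{P}_0^k\Big(\Big|\tfrac1tZ_t^k+I_0^k\Big|>\varepsilon\Big)<\infty,\qquad \sum_{t=1}^\infty t^{r-1}\,\mathsf{P}_1^k\Big(\Big|\tfrac1tZ_t^k-I_1^k\Big|>\varepsilon\Big)<\infty .$$ For $\mathcal{A}\subset\{1,\dots,K\}$ put $I_i^{\mathcal{A}}=\sum_{k\in\mathcal{A}}I_i^k$, $i=0,1$. Then for all real $q$ with $1\le q\le r$, as $\alpha_{\max}=\max(\alpha,\beta)\to0$, $$\mathsf{E}_0[\hat\tau^q]\sim\Big(\frac{|\log\beta|}{\min_{\mathcal{A}\in\mathcal{P}}I_0^{\mathcal{A}}}\Big)^q\sim\inf_{(\tau,d)\in\mathcal{C}_{\alpha,\beta}(\mathcal{P})}\mathsf{E}_0[\tau^q],$$ and for every $\mathcal{A}\in\mathcal{P}$ $$\mathsf{E}^{\mathcal{A}}[\hat\tau^q]\sim\Big(\frac{|\log\alpha|}{I_1^{\mathcal{A}}}\Big)^q\sim\inf_{(\tau,d)\in\mathcal{C}_{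\alpha,\beta}(\mathcal{P})}\mathsf{E}^{\mathcal{A}}[\tau^q].$$
   Context: $\mathbb{N}=\{1,2,\dots\}$; $x\sim y$ means that the ratio $x/y$ tends to $1$ in the indicated limit. There are $K$ channels; in channel $k$ one observes a discrete-time stochastic process $X^k=\{X_t^k\}_{t\in\mathbb{N}}$. For each $k$, $\mathsf{P}_0^k$ ("noise only") and $\mathsf{P}_1^k$ ("signal and noise") are distinct probability measures on the canonical space of $X^k$ that are mutually absolutely continuous when restricted to $\mathscr{F}_t^k=\sigma(X_s^k;1\le s\le t)$, for every $t\in\mathbb{N}$ (no other structure, such as i.i.d. observations, is assumed). The local likelihood ratio and log-likelihood ratio are $\Lambda_t^k=\frac{d\mathsf{P}_1^k}{d\mathsf{P}_0^k}\big|_{\mathscr{F}_t^k}$ and $Z_t^k=\log\Lambda_t^k$. Channels are independent: $\mathsf{P}_0=\mathsf{P}_0^1\times\cdots\times\mathsf{P}_0^K$ is the law of $(X^1,\dots,X^K)$ under the global null $\mathsf{H}_0$, and for $\mathcal{A}\subset\{1,\dots,K\}$, $\mathsf{P}^{\mathcal{A}}$ is the product measure whose $k$-th factor is $\mathsf{P}_1^k$ if $k\in\mathcal{A}$ and $\mathsf{P}_0^k$ if $k\notin\mathcal{A}$. $\mathsf{E}_0,\mathsf{E}^{\mathcal{A}}$ are the corresponding expectations. $\mathscr{F}_t=\sigma(X_s^k;1\le s\le t,1\le k\le K)$, and $Z_t^{\mathcal{A}}=\log\frac{d\mathsf{P}^{\mathcal{A}}}{d\mathsf{P}_0}\big|_{\mathscr{F}_t}=\sum_{k\in\mathcal{A}}Z_t^k$.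 A sequential test is a pair $(\tau,d)$ where $\tau$ is an $\{\mathscr{F}_t\}$-stopping time (possibly infinite) and $d\in\{0,1\}$ is an $\mathscr{F}_\tau$-measurable decision with $\{d=i\}=\{\tau<\infty,\ \mathsf{H}_i\text{ is selected}\}$, $i=0,1$. For $\alpha,\beta\in(0,1)$, $$\mathcal{C}_{\alpha,\beta}(\mathcal{P})=\Big\{(\tau,d):\ \mathsf{P}_0(d=1)\le\alpha\ \text{ and }\ \max_{\mathcal{A}\in\mathcal{P}}\mathsf{P}^{\mathcal{A}}(d=0)\le\beta\Big\}.$$ The Generalized Sequential Likelihood Ratio Test (G-SLRT) with thresholds $a,b>0$ is $$\hat Z_t=\max_{\mathcal{A}\in\mathcal{P}}Z_t^{\mathcal{A}},\qquad \hat\tau=\inf\{t\in\mathbb{N}:\hat Z_t\notin(-a,b)\},$$ with $\hat d=1$ when $\hat Z_{\hat\tau}\ge b$ and $\hat d=0$ when $\hat Z_{\hat\tau}\le-a$. $|\mathcal{P}|$ is the cardinality of $\mathcal{P}$. *)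

theory Defs
  imports "HOL-Probability.Probability"
begin

text \<open>
  Channel \<open>k \<in> {1..K}\<close> takes values in an arbitrary measurable space \<open>S k\<close>. Only the space and the
  sigma-algebra of \<open>S k\<close> are used; the laws of the channel live on the sequence space over \<open>S k\<close>.
\<close>

definition path_space :: "'a measure \<Rightarrow> (nat \<Rightarrow> 'a) measure" where
  "path_space E = (\<Pi>\<^sub>M t\<in>{1..}. E)"

definition channel_filtration :: "'a measure \<Rightarrow> nat \<Rightarrow> (nat \<Rightarrow> 'a) measure" where
  "channel_filtration E t = sigma (space (path_space E))
     {{x \<in> space (path_space E). x s \<in> B} | s B. 1 \<le> s \<and> s \<le> t \<and> B \<in> sets E}"

definition joint_space :: "nat \<Rightarrow> (nat \<Rightarrow> 'a measure) \<Rightarrow> (nat \<Rightarrow> nat \<Rightarrow> 'a) measure" where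
  "joint_space K S = (\<Pi>\<^sub>M k\<in>{1..K}. path_space (S k))"

text \<open>
  The joint filtration is indexed by \<^typ>\<open>enat\<close>, with all observations available at time \<open>\<infinity>\<close>, so
  that the library's \<^const>\<open>stopping_time\<close> and \<^const>\<open>filtration.pre_sigma\<close> apply to
  possibly infinite stopping times.
\<close>

definition joint_filtration ::
    "nat \<Rightarrow> (nat \<Rightarrow> 'a measure) \<Rightarrow> enat \<Rightarrow> (nat \<Rightarrow> nat \<Rightarrow> 'a) measure" where
  "joint_filtration K S t = sigma (space (joint_space K S))
     {{\<omega> \<in> space (joint_space K S). \<omega> k s \<in> B} | k s B.
        k \<in> {1..K} \<and> 1 \<le> s \<and> enat s \<le> t \<and> B \<in> sets (S k)}"

lemma filtration_joint_filtration:
  "filtration (space (joint_space K S)) (joint_filtration K S)"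
proof
  show "space (joint_filtration K S i) = space (joint_space K S)" for i
    unfolding joint_filtration_def by (rule space_measure_of) auto
  show "sets (joint_filtration K S i) \<le> sets (joint_filtration K S j)" if "i \<le> j" for i j
    unfolding joint_filtration_def using that
    by (subst (1 2) sets_measure_of) (auto intro!: sigma_sets_mono' intro: order_trans)
qed

definition global_null :: "nat \<Rightarrow> (nat \<Rightarrow> (nat \<Rightarrow> 'a) measure) \<Rightarrow> (nat \<Rightarrow> nat \<Rightarrow> 'a) measure" where
  "global_null K P0 = (\<Pi>\<^sub>M k\<in>{1..K}. P0 k)"

definition signal_law ::
    "nat \<Rightarrow> (nat \<Rightarrow> (nat \<Rightarrow> 'a) measure) \<Rightarrow> (nat \<Rightarrow> (nat \<Rightarrow> 'a) measure) \<Rightarrow> nat set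
      \<Rightarrow> (nat \<Rightarrow> nat \<Rightarrow> 'a) measure" where
  "signal_law K P0 P1 A = (\<Pi>\<^sub>M k\<in>{1..K}. if k \<in> A then P1 k else P0 k)"

text \<open>
  Log-likelihood ratio of \<open>Q\<close> against \<open>P\<close> on the sub-sigma-algebra \<open>F\<close>. Where the chosen version of
  the density is \<open>0\<close> or \<open>\<infinity>\<close> its value is \<open>0\<close>; under mutual absolute continuity on \<open>F\<close> this
  happens only on a null set.
\<close>

definition log_lr :: "'b measure \<Rightarrow> 'b measure \<Rightarrow> 'b measure \<Rightarrow> 'b \<Rightarrow> real" where
  "log_lr P Q F \<omega> = ln (enn2real (RN_deriv (restr_to_subalg P F) (restr_to_subalg Q F) \<omega>))"

definition channel_llr ::
    "(nat \<Rightarrow> 'a measure) \<Rightarrow> (nat \<Rightarrow> (nat \<Rightarrow> 'a) measure) \<Rightarrow> (nat \<Rightarrow> (nat \<Rightarrow> 'a) measure)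
      \<Rightarrow> nat \<Rightarrow> nat \<Rightarrow> (nat \<Rightarrow> 'a) \<Rightarrow> real" where
  "channel_llr S P0 P1 k t = log_lr (P0 k) (P1 k) (channel_filtration (S k) t)"

definition joint_llr ::
    "nat \<Rightarrow> (nat \<Rightarrow> 'a measure) \<Rightarrow> (nat \<Rightarrow> (nat \<Rightarrow> 'a) measure) \<Rightarrow> (nat \<Rightarrow> (nat \<Rightarrow> 'a) measure)
      \<Rightarrow> nat set \<Rightarrow> nat \<Rightarrow> (nat \<Rightarrow> nat \<Rightarrow> 'a) \<Rightarrow> real" where
  "joint_llr K S P0 P1 A t =
     log_lr (global_null K P0) (signal_law K P0 P1 A) (joint_filtration K S (enat t))"

locale multichannel_model =
  fixes K :: nat
    and S :: "nat \<Rightarrow> 'a measure"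
    and P0 P1 :: "nat \<Rightarrow> (nat \<Rightarrow> 'a) measure"
  assumes prob_space_P0: "k \<in> {1..K} \<Longrightarrow> prob_space (P0 k)"
    and prob_space_P1: "k \<in> {1..K} \<Longrightarrow> prob_space (P1 k)"
    and sets_P0: "k \<in> {1..K} \<Longrightarrow> sets (P0 k) = sets (path_space (S k))"
    and sets_P1: "k \<in> {1..K} \<Longrightarrow> sets (P1 k) = sets (path_space (S k))"
    and distinct_laws: "k \<in> {1..K} \<Longrightarrow> P0 k \<noteq> P1 k"
    and abs_cont_P0_P1: "k \<in> {1..K} \<Longrightarrow> t \<ge> 1 \<Longrightarrow>
      absolutely_continuous (restr_to_subalg (P0 k) (channel_filtration (S k) t))
                            (restr_to_subalg (P1 k) (channel_filtration (S k) t))"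
    and abs_cont_P1_P0: "k \<in> {1..K} \<Longrightarrow> t \<ge> 1 \<Longrightarrow>
      absolutely_continuous (restr_to_subalg (P1 k) (channel_filtration (S k) t))
                            (restr_to_subalg (P0 k) (channel_filtration (S k) t))"

datatype hypothesis = H0 | H1

text \<open>
  The decision is \<^term>\<open>None\<close> exactly when the test never stops, so that the event that the decision
  equals \<open>Some H\<close> is the event that the test stops and selects \<open>H\<close>.
\<close>

definition sequential_tests ::
    "nat \<Rightarrow> (nat \<Rightarrow> 'a measure)
      \<Rightarrow> (((nat \<Rightarrow> nat \<Rightarrow> 'a) \<Rightarrow> enat) \<times> ((nat \<Rightarrow> nat \<Rightarrow> 'a) \<Rightarrow> hypothesis option)) set" where
  "sequential_tests K S = {(\<tau>, d).
     (\<forall>\<omega>\<in>space (joint_space K S). 1 \<le> \<tau> \<omega>) \<and>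
     stopping_time (joint_filtration K S) \<tau> \<and>
     d \<in> filtration.pre_sigma (space (joint_space K S)) (joint_filtration K S) \<tau>
           \<rightarrow>\<^sub>M count_space UNIV \<and>
     (\<forall>\<omega>\<in>space (joint_space K S). d \<omega> = None \<longleftrightarrow> \<tau> \<omega> = \<infinity>)}"

definition test_class ::
    "nat \<Rightarrow> (nat \<Rightarrow> 'a measure) \<Rightarrow> (nat \<Rightarrow> (nat \<Rightarrow> 'a) measure) \<Rightarrow> (nat \<Rightarrow> (nat \<Rightarrow> 'a) measure)
      \<Rightarrow> nat set set \<Rightarrow> real \<Rightarrow> real
      \<Rightarrow> (((nat \<Rightarrow> nat \<Rightarrow> 'a) \<Rightarrow> enat) \<times> ((nat \<Rightarrow> nat \<Rightarrow> 'a) \<Rightarrow> hypothesis option)) set" where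
  "test_class K S P0 P1 \<F> \<alpha> \<beta> = {(\<tau>, d) \<in> sequential_tests K S.
     \<P>(\<omega> in global_null K P0. d \<omega> = Some H1) \<le> \<alpha> \<and>
     (MAX A\<in>\<F>. \<P>(\<omega> in signal_law K P0 P1 A. d \<omega> = Some H0)) \<le> \<beta>}"

definition gslrt_stat ::
    "nat \<Rightarrow> (nat \<Rightarrow> 'a measure) \<Rightarrow> (nat \<Rightarrow> (nat \<Rightarrow> 'a) measure) \<Rightarrow> (nat \<Rightarrow> (nat \<Rightarrow> 'a) measure)
      \<Rightarrow> nat set set \<Rightarrow> nat \<Rightarrow> (nat \<Rightarrow> nat \<Rightarrow> 'a) \<Rightarrow> real" where
  "gslrt_stat K S P0 P1 \<F> t \<omega> = (MAX A\<in>\<F>. joint_llr K S P0 P1 A t \<omega>)"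

definition gslrt_time ::
    "nat \<Rightarrow> (nat \<Rightarrow> 'a measure) \<Rightarrow> (nat \<Rightarrow> (nat \<Rightarrow> 'a) measure) \<Rightarrow> (nat \<Rightarrow> (nat \<Rightarrow> 'a) measure)
      \<Rightarrow> nat set set \<Rightarrow> real \<Rightarrow> real \<Rightarrow> (nat \<Rightarrow> nat \<Rightarrow> 'a) \<Rightarrow> enat" where
  "gslrt_time K S P0 P1 \<F> a b \<omega> =
     Inf {enat t | t. 1 \<le> t \<and> gslrt_stat K S P0 P1 \<F> t \<omega> \<notin> {-a<..<b}}"

definition gslrt_decision ::
    "nat \<Rightarrow> (nat \<Rightarrow> 'a measure) \<Rightarrow> (nat \<Rightarrow> (nat \<Rightarrow> 'a) measure) \<Rightarrow> (nat \<Rightarrow> (nat \<Rightarrow> 'a) measure)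
      \<Rightarrow> nat set set \<Rightarrow> real \<Rightarrow> real \<Rightarrow> (nat \<Rightarrow> nat \<Rightarrow> 'a) \<Rightarrow> hypothesis option" where
  "gslrt_decision K S P0 P1 \<F> a b \<omega> =
     (case gslrt_time K S P0 P1 \<F> a b \<omega> of
        \<infinity> \<Rightarrow> None
      | enat t \<Rightarrow> Some (if gslrt_stat K S P0 P1 \<F> t \<omega> \<ge> b then H1 else H0))"

definition enat_powr :: "enat \<Rightarrow> real \<Rightarrow> ennreal" where
  "enat_powr n q = (case n of enat m \<Rightarrow> ennreal (real m powr q) | \<infinity> \<Rightarrow> \<infinity>)"

text \<open>
  Asymptotic equivalence of extended nonnegative functions: the ratio tends to \<open>1\<close>. As
  \<open>x / \<infinity> = 0\<close> and \<open>x / 0 \<in> {0, \<infinity>}\<close> in \<^typ>\<open>ennreal\<close>, it forces both functions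
  to be eventually finite and positive.
\<close>

definition ennreal_asymp_equiv :: "('b \<Rightarrow> ennreal) \<Rightarrow> 'b filter \<Rightarrow> ('b \<Rightarrow> ennreal) \<Rightarrow> bool" where
  "ennreal_asymp_equiv f F g \<longleftrightarrow> ((\<lambda>x. f x / g x) \<longlongrightarrow> 1) F"

text \<open>
  The limit \<open>max \<alpha> \<beta> \<rightarrow> 0\<close> over \<open>\<alpha>, \<beta> \<in> (0,1)\<close>, with no relation imposed between the rates of \<open>\<alpha>\<close> and \<open>\<beta>\<close>.
\<close>

definition error_limit :: "(real \<times> real) filter" where
  "error_limit = inf (filtercomap (\<lambda>(\<alpha>, \<beta>). max \<alpha> \<beta>) (nhds 0)) (principal ({0<..<1} \<times> {0<..<1}))"

lemma eventually_error_limit: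
  "eventually Q error_limit \<longleftrightarrow>
     (\<exists>\<delta>>0. \<forall>\<alpha> \<beta>. 0 < \<alpha> \<and> \<alpha> < 1 \<and> 0 < \<beta> \<and> \<beta> < 1 \<and> max \<alpha> \<beta> < \<delta> \<longrightarrow> Q (\<alpha>, \<beta>))"
  (is "?L \<longleftrightarrow> ?R")
proof
  assume ?L
  then obtain U where U: "eventually U (nhds (0::real))"
    and UQ: "\<And>\<alpha> \<beta>. U (max \<alpha> \<beta>) \<Longrightarrow> (\<alpha>, \<beta>) \<in> {0<..<1} \<times> {0<..<1} \<Longrightarrow> Q (\<alpha>, \<beta>)"
    unfolding error_limit_def eventually_inf_principal eventually_filtercomap by fastforce
  from U obtain \<delta> where "\<delta> > 0" "\<And>x. dist x 0 < \<delta> \<Longrightarrow> U x"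
    unfolding eventually_nhds_metric by blast
  with UQ show ?R by (intro exI[of _ \<delta>]) (auto simp: dist_real_def)
next
  assume ?R
  then obtain \<delta> where "\<delta> > 0"
    and "\<And>\<alpha> \<beta>. 0 < \<alpha> \<and> \<alpha> < 1 \<and> 0 < \<beta> \<and> \<beta> < 1 \<and> max \<alpha> \<beta> < \<delta> \<Longrightarrow> Q (\<alpha>, \<beta>)" by blast
  then show ?L
    unfolding error_limit_def eventually_inf_principal eventually_filtercomap
    by (intro exI[of _ "\<lambda>x. x < \<delta>"]) (auto intro: order_tendstoD(2)[OF tendsto_ident_at]
      eventually_nhds_in_open[of "{..<\<delta>}" 0, simplified])
qed

end

theory Submission
  imports Defs
begin

text \<open>
  The argument compares upper and lower bounds that both have the form of a deterministic time.

  On the observations up to time \<open>t\<close> the law \<open>P\<^sup>A\<close> has density \<open>exp Z\<close> against the global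
  null, where \<open>Z\<close> is the sum of the channel log-likelihood ratios over \<open>A\<close>
  (\<open>emeasure_law_eq_tilt\<close>); the joint log-likelihood ratio is therefore that sum almost surely under
  every law in play (\<open>joint_llr_AE\<close>). A union bound over the channels transfers the assumed rate of
  convergence to all joint log-likelihood ratios at once (\<open>summable_llr_deviation\<close>): under \<open>P\<^sup>A\<close>,
  the event that the ratio of some \<open>B\<close> leaves the cone of slope \<open>\<delta>\<close> around its drift at time
  \<open>t\<close> has a probability that is summable against \<open>t\<^bsup>r-1\<^esup>\<close>.

  Upper bound. Outside that event, as soon as the drift line minus \<open>\<delta> t\<close> is beyond the
  threshold \<open>h\<close>, the test has stopped; so it can survive a time \<open>t > h / (m - \<delta>)\<close> only on the
  deviation event. As \<open>t\<^sup>q\<close> has increments of order \<open>t\<^bsup>q-1\<^esup>\<close>, at most \<open>t\<^bsup>r-1\<^esup>\<close>, the survival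
  beyond \<open>h / (m - \<delta>)\<close> contributes to the moment at most a constant that does not depend on the
  thresholds (\<open>nn_integral_stopping_time_le\<close>). Under the null all statistics drift downwards and the
  maximum goes below \<open>-a\<close> when the slowest of them does, whence the minimum of the drifts;
  under \<open>P\<^sup>A\<close> the statistic of \<open>A\<close> alone brings the maximum above \<open>b\<close>.

  Lower bound. Let a test with the prescribed error probabilities be given and let \<open>N\<close> be slightly
  smaller than the claimed time. If it stops by time \<open>N\<close>, it either makes an error, or
  decides correctly by time \<open>N\<close>. The latter event is observable at the fixed time \<open>N\<close>, and a
  change of measure on it to the opposite hypothesis costs a factor \<open>exp c\<close>, with \<open>c\<close> slightly above
  the drift up to \<open>N\<close>, except on a deviation event at time \<open>N\<close>. Under the opposite hypothesis the
  event is an error and hence rare enough to absorb that factor (\<open>test_class_early_stopping\<close>).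
  Working with the density at time \<open>N\<close>, instead of at the stopping time, makes convergence in
  probability sufficient, and the bound is uniform over all tests (\<open>nn_integral_test_class_ge\<close>).

  As the generalized sequential likelihood ratio test is itself admissible (\<open>gslrt_in_test_class\<close>),
  its moments lie above the infimum, and the two bounds squeeze both
  (\<open>ennreal_asymp_equiv_sandwich\<close>).
\<close>

section \<open>Likelihood ratios on a sub-sigma-algebra\<close>

lemma borel_measurable_log_lr:
  assumes "subalgebra P F"
  shows "log_lr P Q F \<in> borel_measurable F"
proof -
  have "RN_deriv (restr_to_subalg P F) (restr_to_subalg Q F) \<in> borel_measurable F"
    using borel_measurable_RN_deriv
    by (subst measurable_cong_sets[OF sets_restr_to_subalg[OF assms, symmetric] refl])
  then show ?thesis
    unfolding log_lr_def[abs_def] by measurable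
qed

text \<open>
  Where the density is zero or infinite, \<^const>\<open>log_lr\<close> takes a default value and its exponential
  is not the density. Both exceptional sets are \<open>P\<close>-null: the infinite one since \<open>Q\<close> is
  finite, the zero one since it is \<open>Q\<close>-null and \<open>P\<close> is absolutely continuous with respect to \<open>Q\<close>.
\<close>

lemma emeasure_eq_exp_log_lr:
  assumes P: "finite_measure P" "subalgebra P F" and Q: "finite_measure Q" "subalgebra Q F"
    and PQ: "absolutely_continuous (restr_to_subalg P F) (restr_to_subalg Q F)"
    and QP: "absolutely_continuous (restr_to_subalg Q F) (restr_to_subalg P F)"
    and E: "E \<in> sets F"
  shows "emeasure Q E = (\<integral>\<^sup>+x. ennreal (exp (log_lr P Q F x)) * indicator E x \<partial>P)"
proof -
  let ?P = "restr_to_subalg P F" and ?Q = "restr_to_subalg Q F"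
  let ?R = "RN_deriv ?P ?Q"
  interpret P: finite_measure ?P using P by (rule finite_measure_restr_to_subalg[rotated])
  interpret Q: finite_measure ?Q using Q by (rule finite_measure_restr_to_subalg[rotated])
  have setsP: "sets ?P = sets F" and setsQ: "sets ?Q = sets F"
    using P Q by (simp_all add: sets_restr_to_subalg)
  have sets: "sets ?Q = sets ?P" by (simp add: setsP setsQ)
  have [measurable]: "E \<in> sets ?P" using E setsP by simp
  have RF: "?R \<in> borel_measurable F"
    using borel_measurable_RN_deriv
    by (subst measurable_cong_sets[OF sets_restr_to_subalg[OF P(2), symmetric] refl])
  have dens: "density ?P ?R = ?Q"
    by (rule P.density_RN_deriv[OF PQ sets])
  have fin: "AE x in ?P. ?R x \<noteq> \<infinity>"
    by (rule P.RN_deriv_finite[OF _ PQ sets]) (rule Q.sigma_finite_measure_axioms)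
  have "emeasure ?Q {x\<in>space ?P. ?R x = 0} = (\<integral>\<^sup>+x. ?R x * indicator {x\<in>space ?P. ?R x = 0} x \<partial>?P)"
    by (subst dens[symmetric], rule emeasure_density) auto
  also have "\<dots> = (\<integral>\<^sup>+x. 0 \<partial>?P)"
    by (rule nn_integral_cong) (auto simp: indicator_def)
  finally have "{x\<in>space ?P. ?R x = 0} \<in> null_sets ?Q"
    by (auto simp: null_sets_def sets)
  with QP have "{x\<in>space ?P. ?R x = 0} \<in> null_sets ?P"
    by (auto simp: absolutely_continuous_def)
  then have pos: "AE x in ?P. ?R x \<noteq> 0"
    by (rule AE_I') auto
  have "emeasure Q E = emeasure (density ?P ?R) E"
    unfolding dens using Q(2) E by (simp add: emeasure_restr_to_subalg)
  also have "\<dots> = (\<integral>\<^sup>+x. ?R x * indicator E x \<partial>?P)"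
    by (rule emeasure_density) auto
  also have "\<dots> = (\<integral>\<^sup>+x. ennreal (exp (log_lr P Q F x)) * indicator E x \<partial>?P)"
    using fin pos
    by (intro nn_integral_cong_AE)
       (auto elim!: eventually_elim2 simp: log_lr_def exp_ln_iff enn2real_positive_iff top.not_eq_extremum
          zero_less_iff_neq_zero)
  also have "\<dots> = (\<integral>\<^sup>+x. ennreal (exp (log_lr P Q F x)) * indicator E x \<partial>P)"
    using borel_measurable_log_lr[OF P(2), of Q] E
    by (intro nn_integral_subalgebra2[OF P(2)] borel_measurable_times_ennreal borel_measurable_indicator)
      measurable
  finally show ?thesis .
qed

text \<open>
  Uniqueness of Radon-Nikodym derivatives; it identifies the log-likelihood ratio of product measures,
  for which an explicit candidate is at hand.
\<close>

lemma log_lr_AE_unique: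
  assumes P: "finite_measure P" "subalgebra P F" and Q: "subalgebra Q F"
    and f: "f \<in> borel_measurable F"
    and eq: "\<And>E. E \<in> sets F \<Longrightarrow> emeasure Q E = (\<integral>\<^sup>+x. ennreal (exp (f x)) * indicator E x \<partial>P)"
  shows "AE x in P. log_lr P Q F x = f x"
proof -
  let ?P = "restr_to_subalg P F" and ?Q = "restr_to_subalg Q F"
  interpret P: finite_measure ?P using P by (rule finite_measure_restr_to_subalg[rotated])
  have setsP: "sets ?P = sets F" and setsQ: "sets ?Q = sets F"
    using P Q by (simp_all add: sets_restr_to_subalg)
  have fP: "f \<in> borel_measurable ?P" using f by (rule measurable_in_subalg[OF P(2)])
  have "density ?P (\<lambda>x. ennreal (exp (f x))) = ?Q"
  proof (rule measure_eqI)
    fix E assume "E \<in> sets (density ?P (\<lambda>x. ennreal (exp (f x))))"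
    then have E: "E \<in> sets F" by (simp add: setsP)
    have "emeasure (density ?P (\<lambda>x. ennreal (exp (f x)))) E
        = (\<integral>\<^sup>+x. ennreal (exp (f x)) * indicator E x \<partial>?P)"
      using fP E by (intro emeasure_density) (auto simp: setsP)
    also have "\<dots> = (\<integral>\<^sup>+x. ennreal (exp (f x)) * indicator E x \<partial>P)"
      using f E
      by (intro nn_integral_subalgebra2[OF P(2)] borel_measurable_times_ennreal borel_measurable_indicator)
        measurable
    finally show "emeasure (density ?P (\<lambda>x. ennreal (exp (f x)))) E = emeasure ?Q E"
      using E eq Q by (simp add: emeasure_restr_to_subalg)
  qed (simp add: setsP setsQ)
  from P.RN_deriv_unique[OF _ this] fP
  have "AE x in ?P. ennreal (exp (f x)) = RN_deriv ?P ?Q x" by measurable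
  from AE_restr_to_subalg[OF P(2) this] show ?thesis
  proof eventually_elim
    case (elim x)
    show ?case unfolding log_lr_def elim[symmetric] by simp
  qed
qed

section \<open>The law of a signal pattern as an exponential tilt of the global null\<close>

lemma space_joint_filtration: "space (joint_filtration K S t) = space (joint_space K S)"
  unfolding joint_filtration_def by (rule space_measure_of) auto

lemma space_channel_filtration: "space (channel_filtration E t) = space (path_space E)"
  unfolding channel_filtration_def by (rule space_measure_of) auto

lemma space_joint_space: "space (joint_space K S) = (\<Pi>\<^sub>E k\<in>{1..K}. space (path_space (S k)))"
  by (simp add: joint_space_def space_PiM)

lemma sets_channel_filtration_subset: "sets (channel_filtration E t) \<subseteq> sets (path_space E)"
proof -
  have "{x \<in> space (path_space E). x s \<in> B} \<in> sets (path_space E)" if "1 \<le> s" "B \<in> sets E" for s B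
  proof -
    have [measurable]: "(\<lambda>x. x s) \<in> path_space E \<rightarrow>\<^sub>M E"
      unfolding path_space_def by (rule measurable_component_singleton) (use that in simp)
    show ?thesis using that(2) by measurable
  qed
  then show ?thesis
    unfolding channel_filtration_def
    by (subst sets_measure_of) (auto intro!: sets.sigma_sets_subset)
qed

lemma sets_joint_filtration_subset: "sets (joint_filtration K S t) \<subseteq> sets (joint_space K S)"
proof -
  have "{\<omega> \<in> space (joint_space K S). \<omega> k s \<in> B} \<in> sets (joint_space K S)"
    if "k \<in> {1..K}" "1 \<le> s" "B \<in> sets (S k)" for k s B
  proof -
    have "(\<lambda>\<omega>. \<omega> k) \<in> joint_space K S \<rightarrow>\<^sub>M path_space (S k)"
      unfolding joint_space_def by (rule measurable_component_singleton) (rule that(1))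
    moreover have "(\<lambda>x. x s) \<in> path_space (S k) \<rightarrow>\<^sub>M S k"
      unfolding path_space_def by (rule measurable_component_singleton) (use that in simp)
    ultimately have [measurable]: "(\<lambda>\<omega>. \<omega> k s) \<in> joint_space K S \<rightarrow>\<^sub>M S k"
      by (rule measurable_compose)
    show ?thesis using that(3) by measurable
  qed
  then show ?thesis
    unfolding joint_filtration_def
    by (subst sets_measure_of) (auto intro!: sets.sigma_sets_subset)
qed

lemma measurable_component_joint_filtration:
  assumes k: "k \<in> {1..K}"
  shows "(\<lambda>\<omega>. \<omega> k) \<in> joint_filtration K S (enat t) \<rightarrow>\<^sub>M channel_filtration (S k) t"
  unfolding channel_filtration_def
proof (rule measurable_measure_of)
  show "(\<lambda>\<omega>. \<omega> k) \<in> space (joint_filtration K S (enat t)) \<rightarrow> space (path_space (S k))"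
    using k by (auto simp: space_joint_filtration space_joint_space)
next
  fix Y assume "Y \<in> {{x \<in> space (path_space (S k)). x s \<in> B} |s B. 1 \<le> s \<and> s \<le> t \<and> B \<in> sets (S k)}"
  then obtain s B where Y: "Y = {x \<in> space (path_space (S k)). x s \<in> B}" "1 \<le> s" "s \<le> t" "B \<in> sets (S k)"
    by auto
  have "(\<lambda>\<omega>. \<omega> k) -` Y \<inter> space (joint_filtration K S (enat t))
      = {\<omega> \<in> space (joint_space K S). \<omega> k s \<in> B}"
    using k by (auto simp: Y space_joint_filtration space_joint_space)
  also have "\<dots> \<in> sets (joint_filtration K S (enat t))"
    unfolding joint_filtration_def using k Y by (subst sets_measure_of) (auto intro!: sigma_sets.Basic)
  finally show "(\<lambda>\<omega>. \<omega> k) -` Y \<inter> space (joint_filtration K S (enat t))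
      \<in> sets (joint_filtration K S (enat t))" .
qed auto

text \<open>
  This makes rectangles with sides in the channel filtrations a generating system that is closed under
  intersections, so that two finite measures on the joint filtration can be compared on rectangles.
\<close>

lemma sets_joint_filtration_eq_PiM:
  "sets (joint_filtration K S (enat t)) = sets (\<Pi>\<^sub>M k\<in>{1..K}. channel_filtration (S k) t)"
    (is "sets ?F = sets ?G")
proof (rule antisym)
  have spaceG: "space ?G = space (joint_space K S)"
    by (simp add: space_PiM space_channel_filtration space_joint_space)
  have "{\<omega> \<in> space (joint_space K S). \<omega> k s \<in> B} \<in> sets ?G"
    if "k \<in> {1..K}" "1 \<le> s" "s \<le> t" "B \<in> sets (S k)" for k s B
  proof -
    let ?Y = "{x \<in> space (path_space (S k)). x s \<in> B}"
    have "?Y \<in> sets (channel_filtration (S k) t)"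
      unfolding channel_filtration_def using that by (subst sets_measure_of) (auto intro!: sigma_sets.Basic)
    then have "(\<lambda>\<omega>. \<omega> k) -` ?Y \<inter> space ?G \<in> sets ?G"
      by (intro measurable_sets[OF measurable_component_singleton]) (use that in auto)
    also have "(\<lambda>\<omega>. \<omega> k) -` ?Y \<inter> space ?G = {\<omega> \<in> space (joint_space K S). \<omega> k s \<in> B}"
      unfolding spaceG using that by (auto simp: space_joint_space)
    finally show ?thesis .
  qed
  then have "sigma_sets (space ?G) {{\<omega> \<in> space (joint_space K S). \<omega> k s \<in> B} | k s B.
        k \<in> {1..K} \<and> 1 \<le> s \<and> enat s \<le> enat t \<and> B \<in> sets (S k)} \<subseteq> sets ?G"
    by (intro sets.sigma_sets_subset) auto
  then show "sets ?F \<subseteq> sets ?G"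
    unfolding joint_filtration_def spaceG by (subst sets_measure_of) auto
next
  have "(\<lambda>\<omega> k. \<omega> k) \<in> ?F \<rightarrow>\<^sub>M ?G"
    by (rule measurable_PiM_single')
       (auto simp: measurable_component_joint_filtration space_joint_filtration space_joint_space
          space_channel_filtration)
  from measurable_sets[OF this] have "Y \<inter> space ?F \<in> sets ?F" if "Y \<in> sets ?G" for Y
    using that by auto
  moreover have "space ?F = space ?G"
    by (simp add: space_PiM space_channel_filtration space_joint_space space_joint_filtration)
  ultimately show "sets ?G \<subseteq> sets ?F"
    using sets.sets_into_space by (metis inf.absorb1 subsetI)
qed

context multichannel_model
begin

abbreviation law :: "nat set \<Rightarrow> (nat \<Rightarrow> nat \<Rightarrow> 'a) measure" where
  "law A \<equiv> signal_law K P0 P1 A"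

definition llr_sum :: "nat set \<Rightarrow> nat \<Rightarrow> (nat \<Rightarrow> nat \<Rightarrow> 'a) \<Rightarrow> real" where
  "llr_sum A t \<omega> = (\<Sum>k\<in>A. channel_llr S P0 P1 k t (\<omega> k))"

lemma global_null_eq_law: "global_null K P0 = law {}"
  by (simp add: global_null_def signal_law_def)

lemma prob_space_channel_law: "k \<in> {1..K} \<Longrightarrow> prob_space (if k \<in> A then P1 k else P0 k)"
  using prob_space_P0 prob_space_P1 by simp

lemma prob_space_law: "prob_space (law A)"
  unfolding signal_law_def using prob_space_channel_law by (intro prob_space_PiM)

lemma sets_law: "sets (law A) = sets (joint_space K S)"
  unfolding signal_law_def joint_space_def by (intro sets_PiM_cong) (auto simp: sets_P0 sets_P1)

lemma space_law: "space (law A) = space (joint_space K S)"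
  using sets_law by (rule sets_eq_imp_space_eq)

lemma subalgebra_law: "subalgebra (law A) (joint_filtration K S t)"
  using sets_joint_filtration_subset by (simp add: subalgebra_def sets_law space_law space_joint_filtration)

lemma subalgebra_P0: "k \<in> {1..K} \<Longrightarrow> subalgebra (P0 k) (channel_filtration (S k) t)"
  using sets_channel_filtration_subset sets_eq_imp_space_eq[OF sets_P0]
  by (simp add: subalgebra_def sets_P0 space_channel_filtration)

lemma subalgebra_P1: "k \<in> {1..K} \<Longrightarrow> subalgebra (P1 k) (channel_filtration (S k) t)"
  using sets_channel_filtration_subset sets_eq_imp_space_eq[OF sets_P1]
  by (simp add: subalgebra_def sets_P1 space_channel_filtration)

lemma sets_law_filtration: "E \<in> sets (joint_filtration K S t) \<Longrightarrow> E \<in> sets (law A)"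
  using sets_joint_filtration_subset by (auto simp: sets_law)

lemma measurable_channel_llr:
  "k \<in> {1..K} \<Longrightarrow> channel_llr S P0 P1 k t \<in> borel_measurable (channel_filtration (S k) t)"
  unfolding channel_llr_def by (intro borel_measurable_log_lr subalgebra_P0)

lemma measurable_llr_sum:
  "A \<subseteq> {1..K} \<Longrightarrow> llr_sum A t \<in> borel_measurable (joint_filtration K S (enat t))"
  unfolding llr_sum_def[abs_def]
  by (intro borel_measurable_sum measurable_compose[OF measurable_component_joint_filtration]
      measurable_channel_llr) auto

lemma measurable_joint_llr:
  "joint_llr K S P0 P1 A t \<in> borel_measurable (joint_filtration K S (enat t))"
  unfolding joint_llr_def by (intro borel_measurable_log_lr) (simp add: global_null_eq_law subalgebra_law)

lemma emeasure_P1_eq_tilt: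
  assumes k: "k \<in> {1..K}" and t: "t \<ge> 1" and E: "E \<in> sets (channel_filtration (S k) t)"
  shows "emeasure (P1 k) E
    = (\<integral>\<^sup>+x. ennreal (exp (channel_llr S P0 P1 k t x)) * indicator E x \<partial>P0 k)"
  unfolding channel_llr_def
  by (rule emeasure_eq_exp_log_lr)
     (use k t E in \<open>auto simp: subalgebra_P0 subalgebra_P1 abs_cont_P0_P1 abs_cont_P1_P0
        prob_space_P0 prob_space_P1 prob_space.axioms(1)\<close>)

lemma emeasure_law_PiE:
  assumes "\<And>k. k \<in> {1..K} \<Longrightarrow> E k \<in> sets (path_space (S k))"
  shows "emeasure (law A) (\<Pi>\<^sub>E k\<in>{1..K}. E k)
    = (\<Prod>k\<in>{1..K}. emeasure (if k \<in> A then P1 k else P0 k) (E k))"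
proof -
  \<comment> \<open>The product locale asks for a probability space at every index: one point outside the channels.\<close>
  let ?N = "\<lambda>k. if k \<in> {1..K} then (if k \<in> A then P1 k else P0 k) else count_space {undefined}"
  interpret product_prob_space ?N
    using prob_space_channel_law
    by (intro product_prob_spaceI) (auto intro!: prob_spaceI simp: emeasure_count_space)
  have "law A = PiM {1..K} ?N"
    unfolding signal_law_def by (rule PiM_cong) auto
  then show ?thesis
    by (subst \<open>law A = _\<close>, subst emeasure_PiM) (auto simp: assms sets_P0 sets_P1 intro!: prod.cong)
qed

lemma nn_integral_null_prod:
  assumes "\<And>k. k \<in> {1..K} \<Longrightarrow> f k \<in> borel_measurable (P0 k)"
  shows "(\<integral>\<^sup>+\<omega>. (\<Prod>k\<in>{1..K}. f k (\<omega> k)) \<partial>law {}) = (\<Prod>k\<in>{1..K}. \<integral>\<^sup>+x. f k x \<partial>P0 k)"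
proof -
  let ?N = "\<lambda>k. if k \<in> {1..K} then P0 k else count_space {undefined}"
  interpret product_prob_space ?N
    using prob_space_P0
    by (intro product_prob_spaceI) (auto intro!: prob_spaceI simp: emeasure_count_space)
  have "law {} = PiM {1..K} ?N"
    unfolding signal_law_def by (rule PiM_cong) auto
  then show ?thesis
    by (subst \<open>law {} = _\<close>, subst product_nn_integral_prod) (auto simp: assms intro!: prod.cong)
qed

text \<open>
  Rectangles suffice. On a rectangle the left side factors by independence and the right side by
  Fubini, since the exponential turns the sum over channels into a product; channels outside \<open>A\<close>
  contribute the density \<open>1\<close>, the others are covered by \<open>emeasure_P1_eq_tilt\<close>.
\<close>

lemma emeasure_law_eq_tilt:
  assumes A: "A \<subseteq> {1..K}" and t: "t \<ge> 1" and E: "E \<in> sets (joint_filtration K S (enat t))"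
  shows "emeasure (law A) E = (\<integral>\<^sup>+\<omega>. ennreal (exp (llr_sum A t \<omega>)) * indicator E \<omega> \<partial>law {})"
proof -
  let ?F = "joint_filtration K S (enat t)" and ?G = "\<lambda>k. channel_filtration (S k) t"
  let ?P = "restr_to_subalg (law A) ?F"
  let ?L = "\<lambda>\<omega>. ennreal (exp (llr_sum A t \<omega>))"
  let ?Q = "density (restr_to_subalg (law {}) ?F) ?L"
  let ?Z = "\<lambda>k. channel_llr S P0 P1 k t"
  have L: "?L \<in> borel_measurable ?F"
    using measurable_llr_sum[OF A] by measurable
  have Q: "emeasure ?Q E = (\<integral>\<^sup>+\<omega>. ?L \<omega> * indicator E \<omega> \<partial>law {})" if E: "E \<in> sets ?F" for E
  proof -
    have "emeasure ?Q E = (\<integral>\<^sup>+\<omega>. ?L \<omega> * indicator E \<omega> \<partial>restr_to_subalg (law {}) ?F)"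
      using L E measurable_in_subalg[OF subalgebra_law]
      by (intro emeasure_density) (auto simp: sets_restr_to_subalg[OF subalgebra_law])
    also have "\<dots> = (\<integral>\<^sup>+\<omega>. ?L \<omega> * indicator E \<omega> \<partial>law {})"
      using L E by (intro nn_integral_subalgebra2 subalgebra_law borel_measurable_times_ennreal
          borel_measurable_indicator)
    finally show ?thesis .
  qed
  have P: "emeasure ?P E = emeasure (law A) E" if "E \<in> sets ?F" for E
    by (rule emeasure_restr_to_subalg[OF subalgebra_law that])
  have "?P = ?Q"
  proof (rule measure_eqI_PiM_finite)
    show "sets ?P = sets (PiM {1..K} ?G)" "sets ?Q = sets (PiM {1..K} ?G)"
      by (simp_all add: sets_restr_to_subalg[OF subalgebra_law] sets_joint_filtration_eq_PiM)
  next
    fix E assume E: "\<And>k. k \<in> {1..K} \<Longrightarrow> E k \<in> sets (?G k)"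
    then have rect: "Pi\<^sub>E {1..K} E \<in> sets ?F"
      unfolding sets_joint_filtration_eq_PiM by (intro sets_PiM_I_finite) auto
    have Epath: "E k \<in> sets (path_space (S k))" if "k \<in> {1..K}" for k
      using E[OF that] sets_channel_filtration_subset by auto
    let ?f = "\<lambda>k x. (if k \<in> A then ennreal (exp (?Z k x)) else 1) * indicator (E k) x"
    have f: "?f k \<in> borel_measurable (P0 k)" if k: "k \<in> {1..K}" for k
    proof -
      have [measurable]: "?Z k \<in> borel_measurable (P0 k)" "E k \<in> sets (P0 k)"
        using measurable_from_subalg[OF subalgebra_P0 measurable_channel_llr] Epath k
        by (auto simp: sets_P0)
      show ?thesis by measurable
    qed
    have fint: "(\<integral>\<^sup>+x. ?f k x \<partial>P0 k) = emeasure (if k \<in> A then P1 k else P0 k) (E k)"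
      if k: "k \<in> {1..K}" for k
    proof -
      have "E k \<in> sets (P0 k)" using Epath[OF k] sets_P0[OF k] by simp
      then show ?thesis using emeasure_P1_eq_tilt[OF k t E[OF k]] by simp
    qed
    have prod: "?L \<omega> * indicator (Pi\<^sub>E {1..K} E) \<omega> = (\<Prod>k\<in>{1..K}. ?f k (\<omega> k))"
      if \<omega>: "\<omega> \<in> space (law {})" for \<omega>
    proof -
      have "exp (llr_sum A t \<omega>) = (\<Prod>k\<in>A. exp (?Z k (\<omega> k)))"
        using A by (simp add: llr_sum_def exp_sum finite_subset)
      also have "ennreal \<dots> = (\<Prod>k\<in>A. ennreal (exp (?Z k (\<omega> k))))"
        by (rule prod_ennreal[symmetric]) simp
      also have "\<dots> = (\<Prod>k\<in>{1..K}. if k \<in> A then ennreal (exp (?Z k (\<omega> k))) else 1)"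
        using A by (intro prod.mono_neutral_cong_left) auto
      finally have 1: "?L \<omega> = \<dots>" .
      have 2: "(indicator (Pi\<^sub>E {1..K} E) \<omega> :: ennreal) = (\<Prod>k\<in>{1..K}. indicator (E k) (\<omega> k))"
      proof (cases "\<forall>k\<in>{1..K}. \<omega> k \<in> E k")
        case True
        with \<omega> have "\<omega> \<in> Pi\<^sub>E {1..K} E" by (auto simp: space_law space_joint_space PiE_iff)
        with True show ?thesis by simp
      next
        case False
        then obtain k where "k \<in> {1..K}" "\<omega> k \<notin> E k" by auto
        then show ?thesis by (subst prod_zero) (auto simp: PiE_iff indicator_def intro!: bexI[of _ k])
      qed
      show ?thesis unfolding 1 2 by (simp add: prod.distrib)
    qed
    have "emeasure ?P (Pi\<^sub>E {1..K} E) = (\<Prod>k\<in>{1..K}. \<integral>\<^sup>+x. ?f k x \<partial>P0 k)"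
      unfolding P[OF rect] using fint by (subst emeasure_law_PiE) (auto simp: Epath intro!: prod.cong)
    also have "\<dots> = (\<integral>\<^sup>+\<omega>. (\<Prod>k\<in>{1..K}. ?f k (\<omega> k)) \<partial>law {})"
      by (rule nn_integral_null_prod[symmetric]) (rule f)
    also have "\<dots> = (\<integral>\<^sup>+\<omega>. ?L \<omega> * indicator (Pi\<^sub>E {1..K} E) \<omega> \<partial>law {})"
      by (rule nn_integral_cong, rule prod[symmetric])
    finally show "emeasure ?P (Pi\<^sub>E {1..K} E) = emeasure ?Q (Pi\<^sub>E {1..K} E)"
      using Q[OF rect] by simp
  next
    have "space (PiM {1..K} ?G) = Pi\<^sub>E {1..K} (\<lambda>k. space (?G k))" by (simp add: space_PiM)
    then show "range (\<lambda>_::nat. space (PiM {1..K} ?G)) \<subseteq> prod_algebra {1..K} ?G"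
      by (auto intro!: prod_algebraI_finite)
    interpret law: prob_space "law A" by (rule prob_space_law)
    show "emeasure ?P (space (PiM {1..K} ?G)) \<noteq> \<infinity>" for i :: nat
      using P[of "space (PiM {1..K} ?G)"] law.emeasure_finite
      by (simp add: sets_joint_filtration_eq_PiM)
  qed auto
  then show ?thesis using P[OF E] Q[OF E] by simp
qed

lemma joint_llr_AE_null:
  assumes A: "A \<subseteq> {1..K}" and t: "t \<ge> 1"
  shows "AE \<omega> in law {}. joint_llr K S P0 P1 A t \<omega> = llr_sum A t \<omega>"
  unfolding joint_llr_def global_null_eq_law
  by (intro log_lr_AE_unique subalgebra_law measurable_llr_sum A emeasure_law_eq_tilt t
      prob_space.finite_measure prob_space_law)

text \<open>
  The identity holds almost surely under the global null, its exceptional set is observable at time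
  \<open>t\<close>, and there every \<^term>\<open>law B\<close> has a density with respect to the null.
\<close>

lemma joint_llr_AE:
  assumes A: "A \<subseteq> {1..K}" and B: "B \<subseteq> {1..K}" and t: "t \<ge> 1"
  shows "AE \<omega> in law B. joint_llr K S P0 P1 A t \<omega> = llr_sum A t \<omega>"
proof -
  let ?F = "joint_filtration K S (enat t)"
  let ?E = "{\<omega> \<in> space ?F. joint_llr K S P0 P1 A t \<omega> \<noteq> llr_sum A t \<omega>}"
  have E: "?E \<in> sets ?F"
    by (intro borel_measurable_neq measurable_joint_llr measurable_llr_sum A)
  have "emeasure (law B) ?E = (\<integral>\<^sup>+\<omega>. ennreal (exp (llr_sum B t \<omega>)) * indicator ?E \<omega> \<partial>law {})"
    by (rule emeasure_law_eq_tilt[OF B t E])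
  also have "\<dots> = (\<integral>\<^sup>+\<omega>. 0 \<partial>law {})"
    using joint_llr_AE_null[OF A t]
    by (intro nn_integral_cong_AE) (auto elim!: eventually_mono simp: indicator_def)
  finally have "?E \<in> null_sets (law B)"
    using sets_law_filtration[OF E] by (auto simp: null_sets_def)
  then show ?thesis
    by (rule AE_I') (auto simp: space_law space_joint_filtration)
qed

lemma emeasure_law_eq_joint_tilt:
  assumes A: "A \<subseteq> {1..K}" and t: "t \<ge> 1" and E: "E \<in> sets (joint_filtration K S (enat t))"
  shows "emeasure (law A) E
    = (\<integral>\<^sup>+\<omega>. ennreal (exp (joint_llr K S P0 P1 A t \<omega>)) * indicator E \<omega> \<partial>law {})"
  unfolding emeasure_law_eq_tilt[OF assms]
  using joint_llr_AE_null[OF A t]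
  by (intro nn_integral_cong_AE) (auto elim!: eventually_mono)

text \<open>
  Bounding the density on an event observable at a fixed time turns it into a comparison of
  probabilities. This inequality and its converse below carry all changes of measure in the proof.
\<close>

lemma law_le_null:
  assumes A: "A \<subseteq> {1..K}" and t: "t \<ge> 1" and E: "E \<in> sets (joint_filtration K S (enat t))"
    and le: "\<And>\<omega>. \<omega> \<in> E \<Longrightarrow> joint_llr K S P0 P1 A t \<omega> \<le> c"
  shows "measure (law A) E \<le> exp c * measure (law {}) E"
proof -
  interpret A: prob_space "law A" by (rule prob_space_law)
  interpret N: prob_space "law {}" by (rule prob_space_law)
  have "emeasure (law A) E \<le> (\<integral>\<^sup>+\<omega>. ennreal (exp c) * indicator E \<omega> \<partial>law {})"
    unfolding emeasure_law_eq_joint_tilt[OF A t E]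
    using le by (intro nn_integral_mono) (auto simp: indicator_def)
  also have "\<dots> = ennreal (exp c) * emeasure (law {}) E"
    by (rule nn_integral_cmult_indicator) (rule sets_law_filtration[OF E])
  finally show ?thesis
    by (simp add: A.emeasure_eq_measure N.emeasure_eq_measure flip: ennreal_mult)
qed

lemma null_le_law:
  assumes A: "A \<subseteq> {1..K}" and t: "t \<ge> 1" and E: "E \<in> sets (joint_filtration K S (enat t))"
    and ge: "\<And>\<omega>. \<omega> \<in> E \<Longrightarrow> c \<le> joint_llr K S P0 P1 A t \<omega>"
  shows "measure (law {}) E \<le> exp (- c) * measure (law A) E"
proof -
  interpret A: prob_space "law A" by (rule prob_space_law)
  interpret N: prob_space "law {}" by (rule prob_space_law)
  have "ennreal (exp c) * emeasure (law {}) E = (\<integral>\<^sup>+\<omega>. ennreal (exp c) * indicator E \<omega> \<partial>law {})"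
    by (rule nn_integral_cmult_indicator[symmetric]) (rule sets_law_filtration[OF E])
  also have "\<dots> \<le> emeasure (law A) E"
    unfolding emeasure_law_eq_joint_tilt[OF A t E]
    using ge by (intro nn_integral_mono) (auto simp: indicator_def)
  finally have "exp c * measure (law {}) E \<le> measure (law A) E"
    by (simp add: A.emeasure_eq_measure N.emeasure_eq_measure flip: ennreal_mult)
  then show ?thesis by (simp add: exp_minus field_simps)
qed

end

section \<open>The generalized sequential likelihood ratio test controls both errors\<close>

lemma gslrt_time_le_iff:
  "gslrt_time K S P0 P1 \<F> a b \<omega> \<le> enat t
    \<longleftrightarrow> (\<exists>s\<ge>1. s \<le> t \<and> gslrt_stat K S P0 P1 \<F> s \<omega> \<notin> {-a<..<b})"
proof -
  let ?X = "{enat t |t. 1 \<le> t \<and> gslrt_stat K S P0 P1 \<F> t \<omega> \<notin> {-a<..<b}}"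
  show ?thesis
  proof
    assume "gslrt_time K S P0 P1 \<F> a b \<omega> \<le> enat t"
    then have le: "Inf ?X \<le> enat t" by (simp add: gslrt_time_def)
    then have "?X \<noteq> {}" by (metis Inf_empty enat.simps(3) enat_ord_simps(5) top_enat_def)
    then have "Inf ?X \<in> ?X" by (auto simp: Inf_enat_def intro: LeastI)
    with le show "\<exists>s\<ge>1. s \<le> t \<and> gslrt_stat K S P0 P1 \<F> s \<omega> \<notin> {-a<..<b}" by auto
  next
    assume "\<exists>s\<ge>1. s \<le> t \<and> gslrt_stat K S P0 P1 \<F> s \<omega> \<notin> {-a<..<b}"
    then obtain s where "1 \<le> s" "s \<le> t" "gslrt_stat K S P0 P1 \<F> s \<omega> \<notin> {-a<..<b}" by auto
    then have "Inf ?X \<le> enat s" by (intro Inf_lower) auto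
    with \<open>s \<le> t\<close> show "gslrt_time K S P0 P1 \<F> a b \<omega> \<le> enat t"
      unfolding gslrt_time_def by (meson enat_ord_simps(1) order_trans)
  qed
qed

lemma gslrt_time_eqD:
  assumes "gslrt_time K S P0 P1 \<F> a b \<omega> = enat t"
  shows "1 \<le> t" and "gslrt_stat K S P0 P1 \<F> t \<omega> \<notin> {-a<..<b}"
proof -
  obtain s where s: "1 \<le> s" "s \<le> t" "gslrt_stat K S P0 P1 \<F> s \<omega> \<notin> {-a<..<b}"
    using gslrt_time_le_iff[of K S P0 P1 \<F> a b \<omega> t] assms by auto
  then have "enat t \<le> enat s"
    using gslrt_time_le_iff[of K S P0 P1 \<F> a b \<omega> s] assms by auto
  with s have "s = t" by simp
  with s show "1 \<le> t" "gslrt_stat K S P0 P1 \<F> t \<omega> \<notin> {-a<..<b}" by auto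
qed

context multichannel_model
begin

text \<open>
  Wald's likelihood ratio inequality at a stopping time, in slices: \<open>E n\<close> is the part of an event on
  which the test stops at time \<open>Suc n\<close>, times being counted from \<open>1\<close>.
\<close>

lemma null_le_law_stopped:
  assumes A: "A \<subseteq> {1..K}" and E: "\<And>n. E n \<in> sets (joint_filtration K S (enat (Suc n)))"
    and disj: "disjoint_family E"
    and ge: "\<And>n \<omega>. \<omega> \<in> E n \<Longrightarrow> c \<le> joint_llr K S P0 P1 A (Suc n) \<omega>"
  shows "measure (law {}) (\<Union>n. E n) \<le> exp (- c) * measure (law A) (\<Union>n. E n)"
proof -
  interpret A: prob_space "law A" by (rule prob_space_law)
  interpret N: prob_space "law {}" by (rule prob_space_law)
  have sums1: "(\<lambda>n. measure (law {}) (E n)) sums measure (law {}) (\<Union>n. E n)"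
    using sets_law_filtration[OF E] disj by (intro N.finite_measure_UNION) auto
  have sums2: "(\<lambda>n. exp (- c) * measure (law A) (E n)) sums (exp (- c) * measure (law A) (\<Union>n. E n))"
    using sets_law_filtration[OF E] disj by (intro sums_mult A.finite_measure_UNION) auto
  have "measure (law {}) (E n) \<le> exp (- c) * measure (law A) (E n)" for n
    by (rule null_le_law[OF A _ E ge]) auto
  from sums_le[OF this sums1 sums2] show ?thesis .
qed

lemma law_le_null_stopped:
  assumes A: "A \<subseteq> {1..K}" and E: "\<And>n. E n \<in> sets (joint_filtration K S (enat (Suc n)))"
    and disj: "disjoint_family E"
    and le: "\<And>n \<omega>. \<omega> \<in> E n \<Longrightarrow> joint_llr K S P0 P1 A (Suc n) \<omega> \<le> c"
  shows "measure (law A) (\<Union>n. E n) \<le> exp c * measure (law {}) (\<Union>n. E n)"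
proof -
  interpret A: prob_space "law A" by (rule prob_space_law)
  interpret N: prob_space "law {}" by (rule prob_space_law)
  have sums1: "(\<lambda>n. measure (law A) (E n)) sums measure (law A) (\<Union>n. E n)"
    using sets_law_filtration[OF E] disj by (intro A.finite_measure_UNION) auto
  have sums2: "(\<lambda>n. exp c * measure (law {}) (E n)) sums (exp c * measure (law {}) (\<Union>n. E n))"
    using sets_law_filtration[OF E] disj by (intro sums_mult N.finite_measure_UNION) auto
  have "measure (law A) (E n) \<le> exp c * measure (law {}) (E n)" for n
    by (rule law_le_null[OF A _ E le]) auto
  from sums_le[OF this sums1 sums2] show ?thesis .
qed

lemma measurable_gslrt_stat:
  "finite \<F> \<Longrightarrow> gslrt_stat K S P0 P1 \<F> t \<in> borel_measurable (joint_filtration K S (enat t))"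
  unfolding gslrt_stat_def[abs_def] by (intro borel_measurable_Max measurable_joint_llr)

text \<open>
  The time equals \<open>s\<close> when it is at most \<open>s\<close> but not at most \<open>s - 1\<close>; the guard \<open>s \<ge> 1\<close> is there
  for the truncated subtraction.
\<close>

lemma sets_gslrt_time_eq:
  assumes "finite \<F>" "Measurable.pred (joint_filtration K S (enat s)) (\<lambda>\<omega>. Q \<omega>)"
  shows "{\<omega> \<in> space (joint_space K S). gslrt_time K S P0 P1 \<F> a b \<omega> = enat s \<and> Q \<omega>}
    \<in> sets (joint_filtration K S (enat s))"
proof -
  interpret filtration "space (joint_space K S)" "joint_filtration K S"
    by (rule filtration_joint_filtration)
  let ?M = "joint_filtration K S (enat s)"
  have st: "gslrt_stat K S P0 P1 \<F> u \<in> borel_measurable ?M" if "u \<le> s" for u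
    using measurable_gslrt_stat[OF assms(1), of u] sets_F_mono[of "enat u" "enat s"] that
    by (auto simp: measurable_def space_F)
  have le: "Measurable.pred ?M (\<lambda>\<omega>. gslrt_time K S P0 P1 \<F> a b \<omega> \<le> enat u)" if "u \<le> s" for u
  proof -
    have "Measurable.pred ?M (\<lambda>\<omega>. \<exists>v\<in>{1..u}. gslrt_stat K S P0 P1 \<F> v \<omega> \<notin> {-a<..<b})"
    proof (rule pred_intros_finite(4))
      fix v assume "v \<in> {1..u}"
      with that have [measurable]: "gslrt_stat K S P0 P1 \<F> v \<in> borel_measurable ?M"
        by (intro st) auto
      show "Measurable.pred ?M (\<lambda>\<omega>. gslrt_stat K S P0 P1 \<F> v \<omega> \<notin> {-a<..<b})"
        by measurable
    qed auto
    also have "(\<lambda>\<omega>. \<exists>v\<in>{1..u}. gslrt_stat K S P0 P1 \<F> v \<omega> \<notin> {-a<..<b})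
        = (\<lambda>\<omega>. gslrt_time K S P0 P1 \<F> a b \<omega> \<le> enat u)"
      by (rule ext) (simp only: gslrt_time_le_iff Bex_def atLeastAtMost_iff conj_assoc)
    finally show ?thesis .
  qed
  have eq: "gslrt_time K S P0 P1 \<F> a b \<omega> = enat s \<longleftrightarrow>
      gslrt_time K S P0 P1 \<F> a b \<omega> \<le> enat s \<and>
      \<not> (s \<ge> 1 \<and> gslrt_time K S P0 P1 \<F> a b \<omega> \<le> enat (s - 1))" for \<omega>
    by (cases "gslrt_time K S P0 P1 \<F> a b \<omega>") auto
  have "{\<omega> \<in> space ?M. (gslrt_time K S P0 P1 \<F> a b \<omega> \<le> enat s \<and>
      \<not> (s \<ge> 1 \<and> gslrt_time K S P0 P1 \<F> a b \<omega> \<le> enat (s - 1))) \<and> Q \<omega>} \<in> sets ?M"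
    using le[of s] le[of "s - 1"] assms(2)
    by (intro sets.sets_Collect_conj sets.sets_Collect_neg sets.sets_Collect_const) (auto simp: pred_def)
  then show ?thesis unfolding eq space_F .
qed

lemma stopping_time_gslrt:
  assumes "finite \<F>"
  shows "stopping_time (joint_filtration K S) (gslrt_time K S P0 P1 \<F> a b)"
proof
  interpret filtration "space (joint_space K S)" "joint_filtration K S"
    by (rule filtration_joint_filtration)
  fix u
  show "Measurable.pred (joint_filtration K S u) (\<lambda>\<omega>. gslrt_time K S P0 P1 \<F> a b \<omega> \<le> u)"
  proof (cases u)
    case (enat n)
    have "{\<omega> \<in> space (joint_space K S). gslrt_time K S P0 P1 \<F> a b \<omega> = enat s \<and> True}
        \<in> sets (joint_filtration K S u)" if "s \<le> n" for s
      using sets_gslrt_time_eq[OF assms, where s=s and Q="\<lambda>_. True" and a=a and b=b] sets_F_mono[of "enat s" u] that enat by auto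
    then have "(\<Union>s\<le>n. {\<omega> \<in> space (joint_space K S). gslrt_time K S P0 P1 \<F> a b \<omega> = enat s \<and> True})
        \<in> sets (joint_filtration K S u)"
      by (intro sets.finite_UN) auto
    also have "(\<Union>s\<le>n. {\<omega> \<in> space (joint_space K S). gslrt_time K S P0 P1 \<F> a b \<omega> = enat s \<and> True})
        = {\<omega> \<in> space (joint_filtration K S u). gslrt_time K S P0 P1 \<F> a b \<omega> \<le> u}"
    proof (rule set_eqI)
      fix \<omega>
      show "\<omega> \<in> (\<Union>s\<le>n. {\<omega> \<in> space (joint_space K S). gslrt_time K S P0 P1 \<F> a b \<omega> = enat s \<and> True})
          \<longleftrightarrow> \<omega> \<in> {\<omega> \<in> space (joint_filtration K S u). gslrt_time K S P0 P1 \<F> a b \<omega> \<le> u}"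
        unfolding enat space_F by (cases "gslrt_time K S P0 P1 \<F> a b \<omega>") auto
    qed
    finally show ?thesis by (simp add: pred_def)
  qed auto
qed

lemma gslrt_sequential_test:
  assumes fin: "finite \<F>"
  shows "(gslrt_time K S P0 P1 \<F> a b, gslrt_decision K S P0 P1 \<F> a b) \<in> sequential_tests K S"
proof -
  interpret filtration "space (joint_space K S)" "joint_filtration K S"
    by (rule filtration_joint_filtration)
  let ?T = "gslrt_time K S P0 P1 \<F> a b" and ?d = "gslrt_decision K S P0 P1 \<F> a b"
  let ?st = "gslrt_stat K S P0 P1 \<F>"
  note T = stopping_time_gslrt[OF fin]
  have "1 \<le> ?T \<omega>" for \<omega>
    unfolding gslrt_time_def by (rule Inf_greatest) (auto simp: one_enat_def)
  moreover have None: "?d \<omega> = None \<longleftrightarrow> ?T \<omega> = \<infinity>" for \<omega>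
    by (simp add: gslrt_decision_def split: enat.split)
  moreover have "?d \<in> pre_sigma ?T \<rightarrow>\<^sub>M count_space UNIV"
  proof -
    have Some: "{\<omega> \<in> space (joint_space K S). ?d \<omega> = Some h} \<in> sets (pre_sigma ?T)" for h
    proof (rule sets_pre_sigmaI[OF T])
      fix u
      let ?E = "\<lambda>s. {\<omega> \<in> space (joint_space K S). ?T \<omega> = enat s \<and> ((?st s \<omega> \<ge> b) = (h = H1))}"
      have "?E s \<in> sets (joint_filtration K S u)" if "enat s \<le> u" for s
      proof -
        note [measurable] = measurable_gslrt_stat[OF fin, of s]
        have "?E s \<in> sets (joint_filtration K S (enat s))"
          by (rule sets_gslrt_time_eq[OF fin]) measurable
        with sets_F_mono[OF that] show ?thesis by auto
      qed
      then have "(\<Union>s\<in>{s. enat s \<le> u}. ?E s) \<in> sets (joint_filtration K S u)"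
        by (intro sets.countable_UN'') auto
      also have "(\<Union>s\<in>{s. enat s \<le> u}. ?E s)
          = {\<omega> \<in> {\<omega> \<in> space (joint_space K S). ?d \<omega> = Some h}. ?T \<omega> \<le> u}"
      proof (rule set_eqI)
        fix \<omega>
        show "\<omega> \<in> (\<Union>s\<in>{s. enat s \<le> u}. ?E s)
            \<longleftrightarrow> \<omega> \<in> {\<omega> \<in> {\<omega> \<in> space (joint_space K S). ?d \<omega> = Some h}. ?T \<omega> \<le> u}"
          by (cases "?T \<omega>"; cases h) (auto simp: gslrt_decision_def)
      qed
      finally show "{\<omega> \<in> {\<omega> \<in> space (joint_space K S). ?d \<omega> = Some h}. ?T \<omega> \<le> u}
          \<in> sets (joint_filtration K S u)" .
    qed
    have hyp: "x = None \<longleftrightarrow> x \<noteq> Some H0 \<and> x \<noteq> Some H1" for x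
    proof (cases x)
      case (Some h)
      then show ?thesis by (cases h) auto
    qed simp
    have "{\<omega> \<in> space (joint_space K S). ?d \<omega> = y} \<in> sets (pre_sigma ?T)" for y
    proof (cases y)
      case None
      have "{\<omega> \<in> space (joint_space K S). ?d \<omega> = y}
          = space (pre_sigma ?T) - (\<Union>h\<in>{H0,H1}. {\<omega> \<in> space (joint_space K S). ?d \<omega> = Some h})"
        unfolding None space_pre_sigma using hyp by auto
      then show ?thesis using Some by auto
    qed (simp add: Some)
    then have "?d -` {y} \<inter> space (pre_sigma ?T) \<in> sets (pre_sigma ?T)" for y
      unfolding space_pre_sigma by (simp add: vimage_def Int_def conj_commute)
    moreover have "countable (UNIV :: hypothesis option set)"
    proof -
      have "UNIV \<subseteq> {None, Some H0, Some H1}" using hyp by auto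
      then show ?thesis by (rule countable_subset) auto
    qed
    ultimately show ?thesis by (subst measurable_count_space_eq_countable) auto
  qed
  ultimately show ?thesis using T by (auto simp: sequential_tests_def)
qed

text \<open>
  Under the null an upward crossing of the maximum is an upward crossing of the statistic of some
  \<open>A\<close>, and the union bound over these costs the factor \<^term>\<open>card \<F>\<close> that the threshold \<open>b\<close>
  compensates. Under \<open>P\<^sup>A\<close> a downward crossing of the maximum forces the statistic of that same \<open>A\<close>
  below \<open>- a\<close>, so \<open>a\<close> needs no such correction.
\<close>

lemma gslrt_in_test_class:
  assumes F: "\<F> \<subseteq> Pow {1..K}" "\<F> \<noteq> {}"
    and \<alpha>: "0 < \<alpha>" "\<alpha> < 1" and \<beta>: "0 < \<beta>" "\<beta> < 1"
  defines "a \<equiv> \<bar>ln \<beta>\<bar>" and "b \<equiv> \<bar>ln (\<alpha> / real (card \<F>))\<bar>"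
  shows "(gslrt_time K S P0 P1 \<F> a b, gslrt_decision K S P0 P1 \<F> a b) \<in> test_class K S P0 P1 \<F> \<alpha> \<beta>"
proof -
  let ?T = "gslrt_time K S P0 P1 \<F> a b" and ?d = "gslrt_decision K S P0 P1 \<F> a b"
  let ?\<Omega> = "space (joint_space K S)" and ?Z = "joint_llr K S P0 P1"
  let ?st = "gslrt_stat K S P0 P1 \<F>"
  interpret N: prob_space "law {}" by (rule prob_space_law)
  have fin: "finite \<F>" using F(1) by (rule finite_subset) simp
  then have card: "real (card \<F>) \<ge> 1" using F(2) by (simp add: Suc_leI card_gt_0_iff)
  have lt1: "\<alpha> / real (card \<F>) < 1" and pos: "\<alpha> / real (card \<F>) > 0"
    using \<alpha> card by (auto simp: field_simps)
  have a: "exp (- a) = \<beta>" "a > 0" using \<beta> by (auto simp: a_def)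
  have b: "exp (- b) = \<alpha> / real (card \<F>)" "b > 0"
    using pos lt1 ln_less_zero[OF pos lt1] by (auto simp: b_def)
  have "measure (law {}) {\<omega> \<in> space (law {}). ?d \<omega> = Some H1} \<le> \<alpha>"
  proof -
    let ?E = "\<lambda>A n. {\<omega> \<in> ?\<Omega>. ?T \<omega> = enat (Suc n) \<and> b \<le> ?Z A (Suc n) \<omega>}"
    have E: "?E A n \<in> sets (joint_filtration K S (enat (Suc n)))" for A n
    proof (rule sets_gslrt_time_eq[OF fin])
      note [measurable] = measurable_joint_llr[of A "Suc n"]
      show "Measurable.pred (joint_filtration K S (enat (Suc n))) (\<lambda>\<omega>. b \<le> ?Z A (Suc n) \<omega>)"
        by measurable
    qed
    have sub: "{\<omega> \<in> space (law {}). ?d \<omega> = Some H1} \<subseteq> (\<Union>A\<in>\<F>. \<Union>n. ?E A n)"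
    proof
      fix \<omega> assume \<omega>: "\<omega> \<in> {\<omega> \<in> space (law {}). ?d \<omega> = Some H1}"
      then obtain t where t: "?T \<omega> = enat t" "?st t \<omega> \<ge> b"
        by (auto simp: gslrt_decision_def split: enat.splits if_splits)
      then obtain n where n: "t = Suc n" using gslrt_time_eqD(1)[OF t(1)] by (cases t) auto
      have "?st t \<omega> \<in> (\<lambda>A. ?Z A t \<omega>) ` \<F>"
        unfolding gslrt_stat_def using fin F(2) by (intro Max_in) auto
      then show "\<omega> \<in> (\<Union>A\<in>\<F>. \<Union>n. ?E A n)"
        using \<omega> t n by (auto simp: space_law)
    qed
    have UN: "(\<Union>n. ?E A n) \<in> sets (law {})" for A
      using sets_law_filtration[OF E] by auto
    have "measure (law {}) {\<omega> \<in> space (law {}). ?d \<omega> = Some H1}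
        \<le> measure (law {}) (\<Union>A\<in>\<F>. \<Union>n. ?E A n)"
      by (rule N.finite_measure_mono[OF sub sets.finite_UN[OF fin UN]])
    also have "\<dots> \<le> (\<Sum>A\<in>\<F>. measure (law {}) (\<Union>n. ?E A n))"
      using UN fin by (intro N.finite_measure_subadditive_finite) auto
    also have "\<dots> \<le> (\<Sum>A\<in>\<F>. exp (- b))"
    proof (rule sum_mono)
      fix A assume A: "A \<in> \<F>"
      interpret A: prob_space "law A" by (rule prob_space_law)
      have "measure (law {}) (\<Union>n. ?E A n) \<le> exp (- b) * measure (law A) (\<Union>n. ?E A n)"
        by (rule null_le_law_stopped[OF _ E]) (use A F in \<open>auto simp: disjoint_family_on_def\<close>)
      also have "\<dots> \<le> exp (- b) * 1" by (intro mult_left_mono A.prob_le_1) simp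
      finally show "measure (law {}) (\<Union>n. ?E A n) \<le> exp (- b)" by simp
    qed
    also have "\<dots> = \<alpha>" using card by (simp add: b)
    finally show ?thesis .
  qed
  moreover have "measure (law A) {\<omega> \<in> space (law A). ?d \<omega> = Some H0} \<le> \<beta>" if A: "A \<in> \<F>" for A
  proof -
    interpret A: prob_space "law A" by (rule prob_space_law)
    let ?E = "\<lambda>n. {\<omega> \<in> ?\<Omega>. ?T \<omega> = enat (Suc n) \<and> ?Z A (Suc n) \<omega> \<le> - a}"
    have E: "?E n \<in> sets (joint_filtration K S (enat (Suc n)))" for n
    proof (rule sets_gslrt_time_eq[OF fin])
      note [measurable] = measurable_joint_llr[of A "Suc n"]
      show "Measurable.pred (joint_filtration K S (enat (Suc n))) (\<lambda>\<omega>. ?Z A (Suc n) \<omega> \<le> - a)"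
        by measurable
    qed
    have sub: "{\<omega> \<in> space (law A). ?d \<omega> = Some H0} \<subseteq> (\<Union>n. ?E n)"
    proof
      fix \<omega> assume \<omega>: "\<omega> \<in> {\<omega> \<in> space (law A). ?d \<omega> = Some H0}"
      then obtain t where t: "?T \<omega> = enat t" "\<not> ?st t \<omega> \<ge> b"
        by (auto simp: gslrt_decision_def split: enat.splits if_splits)
      then have "?st t \<omega> \<le> - a" using gslrt_time_eqD(2)[OF t(1)] by auto
      moreover have "?Z A t \<omega> \<le> ?st t \<omega>"
        unfolding gslrt_stat_def using fin A by (intro Max_ge) auto
      moreover obtain n where "t = Suc n" using gslrt_time_eqD(1)[OF t(1)] by (cases t) auto
      ultimately show "\<omega> \<in> (\<Union>n. ?E n)" using \<omega> t by (auto simp: space_law)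
    qed
    have "measure (law A) {\<omega> \<in> space (law A). ?d \<omega> = Some H0} \<le> measure (law A) (\<Union>n. ?E n)"
      using sub sets_law_filtration[OF E] by (intro A.finite_measure_mono) auto
    also have "\<dots> \<le> exp (- a) * measure (law {}) (\<Union>n. ?E n)"
      by (rule law_le_null_stopped[OF _ E]) (use A F in \<open>auto simp: disjoint_family_on_def\<close>)
    also have "\<dots> \<le> exp (- a) * 1" by (intro mult_left_mono N.prob_le_1) simp
    finally show ?thesis by (simp add: a)
  qed
  ultimately show ?thesis
    using gslrt_sequential_test[OF fin] fin F(2) by (auto simp: test_class_def global_null_eq_law)
qed

end

section \<open>Concentration of the log-likelihood ratios\<close>

lemma summable_on_atLeast_1_iff:
  fixes f :: "nat \<Rightarrow> real"
  assumes "\<And>n. 0 \<le> f n"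
  shows "f summable_on {1..} \<longleftrightarrow> summable f"
proof -
  have "(UNIV :: nat set) = insert 0 {1..}" by auto
  then have "f summable_on {1..} \<longleftrightarrow> f summable_on UNIV"
    using summable_on_insert_iff[of f 0 "{1..}"] by metis
  then show ?thesis by (simp only: summable_on_UNIV_nonneg_real_iff[OF assms])
qed

text \<open>
  For \<open>n \<ge> 1\<close> the weight \<open>n\<^sup>p\<close> is at least \<open>1\<close>, so the probabilities are dominated by the terms
  of a convergent series.
\<close>

lemma (in prob_space) complete_convergence_imp_in_prob:
  assumes "summable (\<lambda>n. real n ^ p * prob (B n))"
  shows "(\<lambda>n. prob (B n)) \<longlonglongrightarrow> 0"
proof (rule tendsto_sandwich)
  show "\<forall>\<^sub>F n in sequentially. 0 \<le> prob (B n)" by simp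
  show "\<forall>\<^sub>F n in sequentially. prob (B n) \<le> real n ^ p * prob (B n)"
    using eventually_ge_at_top[of 1]
  proof eventually_elim
    case (elim n)
    then have "1 \<le> real n ^ p" by (intro one_le_power) simp
    from mult_right_mono[OF this, of "prob (B n)"] show ?case by simp
  qed
  show "(\<lambda>n. real n ^ p * prob (B n)) \<longlonglongrightarrow> 0" by (rule summable_LIMSEQ_zero[OF assms])
qed simp

text \<open>
  The slope at which the log-likelihood ratio of the pattern \<open>B\<close> grows when the signals are in \<open>A\<close>.
\<close>

definition drift :: "(nat \<Rightarrow> real) \<Rightarrow> (nat \<Rightarrow> real) \<Rightarrow> nat set \<Rightarrow> nat set \<Rightarrow> real" where
  "drift I0 I1 A B = (\<Sum>k\<in>B. if k \<in> A then I1 k else - I0 k)"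

context multichannel_model
begin

definition llr_deviation ::
    "(nat \<Rightarrow> real) \<Rightarrow> (nat \<Rightarrow> real) \<Rightarrow> nat set set \<Rightarrow> nat set \<Rightarrow> real \<Rightarrow> nat \<Rightarrow> (nat \<Rightarrow> nat \<Rightarrow> 'a) set" where
  "llr_deviation I0 I1 \<F> A \<delta> t = {\<omega> \<in> space (joint_space K S).
     \<exists>B\<in>\<F>. \<delta> * real t < \<bar>joint_llr K S P0 P1 B t \<omega> - real t * drift I0 I1 A B\<bar>}"

lemma measurable_law_llr: "joint_llr K S P0 P1 B t \<in> borel_measurable (law A)"
  by (rule measurable_from_subalg[OF subalgebra_law measurable_joint_llr])

lemma sets_llr_deviation:
  assumes "finite \<F>"
  shows "llr_deviation I0 I1 \<F> A \<delta> t \<in> sets (law C)"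
proof -
  have "{\<omega> \<in> space (law C). \<delta> * real t < \<bar>joint_llr K S P0 P1 B t \<omega> - real t * drift I0 I1 A B\<bar>}
      \<in> sets (law C)" for B
  proof -
    note [measurable] = measurable_law_llr[of B t C]
    show ?thesis by measurable
  qed
  then have "(\<Union>B\<in>\<F>. {\<omega> \<in> space (law C). \<delta> * real t < \<bar>joint_llr K S P0 P1 B t \<omega> - real t * drift I0 I1 A B\<bar>})
      \<in> sets (law C)" by (intro sets.finite_UN assms)
  also have "(\<Union>B\<in>\<F>. {\<omega> \<in> space (law C). \<delta> * real t < \<bar>joint_llr K S P0 P1 B t \<omega> - real t * drift I0 I1 A B\<bar>})
      = llr_deviation I0 I1 \<F> A \<delta> t"
    by (auto simp: llr_deviation_def space_law)
  finally show ?thesis .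
qed

lemma measure_law_component:
  assumes k: "k \<in> {1..K}" and Y: "Y \<in> sets (path_space (S k))"
  shows "{\<omega> \<in> space (law A). \<omega> k \<in> Y} \<in> sets (law A)"
    and "measure (law A) {\<omega> \<in> space (law A). \<omega> k \<in> Y} = measure (if k \<in> A then P1 k else P0 k) Y"
proof -
  let ?N = "\<lambda>k. if k \<in> A then P1 k else P0 k"
  have m: "(\<lambda>\<omega>. \<omega> k) \<in> law A \<rightarrow>\<^sub>M ?N k"
    unfolding signal_law_def by (rule measurable_component_singleton[OF k])
  have Y: "Y \<in> sets (?N k)" using k Y by (simp add: sets_P0 sets_P1)
  have eq: "(\<lambda>\<omega>. \<omega> k) -` Y \<inter> space (law A) = {\<omega> \<in> space (law A). \<omega> k \<in> Y}" by auto
  show "{\<omega> \<in> space (law A). \<omega> k \<in> Y} \<in> sets (law A)"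
    using measurable_sets[OF m Y] unfolding eq .
  have "distr (law A) (?N k) (\<lambda>\<omega>. \<omega> k) = ?N k"
    unfolding signal_law_def by (rule distr_PiM_component[OF prob_space_channel_law k])
  then have "measure (?N k) Y = measure (distr (law A) (?N k) (\<lambda>\<omega>. \<omega> k)) Y" by simp
  also have "\<dots> = measure (law A) {\<omega> \<in> space (law A). \<omega> k \<in> Y}"
    unfolding measure_distr[OF m Y] eq ..
  finally show "measure (law A) {\<omega> \<in> space (law A). \<omega> k \<in> Y} = measure (?N k) Y" by simp
qed

text \<open>
  If the joint ratio of some \<open>B\<close> deviates by more than \<open>\<delta>\<close> per time unit, then one of its at most
  \<open>K\<close> channels deviates by more than its share of \<open>\<delta>\<close>, and the event for a single channel has the
  probability that the assumption controls. The inclusion holds only almost surely, because the joint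
  ratio equals the sum of the channel ratios only almost surely.
\<close>

lemma summable_llr_deviation:
  assumes F: "\<F> \<subseteq> Pow {1..K}" and A: "A \<subseteq> {1..K}" and \<delta>: "0 < \<delta>"
    and conv0: "\<And>k \<epsilon>. k \<in> {1..K} \<Longrightarrow> \<epsilon> > 0 \<Longrightarrow>
      (\<lambda>t. real t ^ p *
         \<P>(x in P0 k. \<bar>channel_llr S P0 P1 k t x / real t + I0 k\<bar> > \<epsilon>)) summable_on {1..}"
    and conv1: "\<And>k \<epsilon>. k \<in> {1..K} \<Longrightarrow> \<epsilon> > 0 \<Longrightarrow>
      (\<lambda>t. real t ^ p *
         \<P>(x in P1 k. \<bar>channel_llr S P0 P1 k t x / real t - I1 k\<bar> > \<epsilon>)) summable_on {1..}"
  shows "summable (\<lambda>t. real t ^ p * measure (law A) (llr_deviation I0 I1 \<F> A \<delta> t))"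
proof -
  interpret A: prob_space "law A" by (rule prob_space_law)
  \<comment> \<open>Dividing by \<open>K + 1\<close> keeps the share positive and well defined for \<open>K = 0\<close>.\<close>
  define \<epsilon> where "\<epsilon> = \<delta> / real (K + 1)"
  have \<epsilon>: "0 < \<epsilon>" using \<delta> by (simp add: \<epsilon>_def)
  let ?N = "\<lambda>k. if k \<in> A then P1 k else P0 k" and ?\<mu> = "\<lambda>k. if k \<in> A then I1 k else - I0 k"
  let ?Z = "channel_llr S P0 P1"
  let ?Y = "\<lambda>k t. {x \<in> space (?N k). \<bar>?Z k t x / real t - ?\<mu> k\<bar> > \<epsilon>}"
  have Y: "?Y k t \<in> sets (path_space (S k))" if k: "k \<in> {1..K}" for k t
  proof -
    have sub: "subalgebra (?N k) (channel_filtration (S k) t)"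
      using subalgebra_P0[OF k] subalgebra_P1[OF k] by simp
    note [measurable] = measurable_from_subalg[OF sub measurable_channel_llr[OF k]]
    have "?Y k t \<in> sets (?N k)" by measurable
    moreover have "sets (?N k) = sets (path_space (S k))" using sets_P0[OF k] sets_P1[OF k] by simp
    ultimately show ?thesis by (simp only:)
  qed
  have summ: "summable (\<lambda>t. real t ^ p * measure (?N k) (?Y k t))" if k: "k \<in> {1..K}" for k
  proof -
    have "(\<lambda>t. real t ^ p * measure (?N k) (?Y k t)) summable_on {1..}"
      using conv0[OF k \<epsilon>] conv1[OF k \<epsilon>] by (cases "k \<in> A") simp_all
    then show ?thesis by (subst (asm) summable_on_atLeast_1_iff) auto
  qed
  have bound: "measure (law A) (llr_deviation I0 I1 \<F> A \<delta> t) \<le> (\<Sum>k\<in>{1..K}. measure (?N k) (?Y k t))"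
    if t: "1 \<le> t" for t
  proof -
    let ?E = "\<lambda>k. {\<omega> \<in> space (law A). \<omega> k \<in> ?Y k t}"
    have E: "?E k \<in> sets (law A)" if "k \<in> {1..K}" for k
      by (rule measure_law_component(1)[OF that Y[OF that]])
    have "AE \<omega> in law A. \<forall>B\<in>\<F>. joint_llr K S P0 P1 B t \<omega> = llr_sum B t \<omega>"
    proof (rule AE_finite_allI)
      show "finite \<F>" using F by (rule finite_subset) simp
      show "AE \<omega> in law A. joint_llr K S P0 P1 B t \<omega> = llr_sum B t \<omega>" if "B \<in> \<F>" for B
        using that F by (intro joint_llr_AE A t) blast
    qed
    then have "AE \<omega> in law A. \<omega> \<in> llr_deviation I0 I1 \<F> A \<delta> t \<longrightarrow> \<omega> \<in> (\<Union>k\<in>{1..K}. ?E k)"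
    proof eventually_elim
      case (elim \<omega>)
      show ?case
      proof (rule impI, rule ccontr)
        assume dev: "\<omega> \<in> llr_deviation I0 I1 \<F> A \<delta> t" and no: "\<omega> \<notin> (\<Union>k\<in>{1..K}. ?E k)"
        then have \<omega>: "\<omega> \<in> space (law A)" by (simp add: llr_deviation_def space_law)
        from dev obtain B where B: "B \<in> \<F>"
          "\<delta> * real t < \<bar>joint_llr K S P0 P1 B t \<omega> - real t * drift I0 I1 A B\<bar>"
          by (auto simp: llr_deviation_def)
        have BK: "B \<subseteq> {1..K}" using B F by auto
        have "joint_llr K S P0 P1 B t \<omega> - real t * drift I0 I1 A B
            = (\<Sum>k\<in>B. ?Z k t (\<omega> k) - real t * ?\<mu> k)"
          using elim B(1) by (simp add: llr_sum_def drift_def sum_subtractf sum_distrib_left)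
        also have "\<bar>\<dots>\<bar> \<le> (\<Sum>k\<in>B. \<bar>?Z k t (\<omega> k) - real t * ?\<mu> k\<bar>)" by (rule sum_abs)
        also have "\<dots> \<le> (\<Sum>k\<in>B. real t * \<epsilon>)"
        proof (rule sum_mono)
          fix k assume "k \<in> B"
          then have k: "k \<in> {1..K}" using BK by auto
          have "\<omega> k \<in> space (?N k)"
            using \<omega> k unfolding signal_law_def space_PiM by (auto simp: PiE_iff)
          with no k \<omega> have le: "\<bar>?Z k t (\<omega> k) / real t - ?\<mu> k\<bar> \<le> \<epsilon>" by auto
          have "?Z k t (\<omega> k) - real t * ?\<mu> k = real t * (?Z k t (\<omega> k) / real t - ?\<mu> k)"
            using t by (simp add: right_diff_distrib)
          then show "\<bar>?Z k t (\<omega> k) - real t * ?\<mu> k\<bar> \<le> real t * \<epsilon>"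
            using mult_left_mono[OF le, of "real t"] by (simp add: abs_mult)
        qed
        also have "\<dots> = real (card B) * (real t * \<epsilon>)" by simp
        also have "\<dots> \<le> real (K + 1) * (real t * \<epsilon>)"
          using card_mono[OF _ BK] \<epsilon> by (intro mult_right_mono) auto
        also have "\<dots> = \<delta> * real t" by (simp add: \<epsilon>_def field_simps)
        finally show False using B(2) by simp
      qed
    qed
    then have "measure (law A) (llr_deviation I0 I1 \<F> A \<delta> t) \<le> measure (law A) (\<Union>k\<in>{1..K}. ?E k)"
      using E by (intro A.finite_measure_mono_AE sets.finite_UN) auto
    also have "\<dots> \<le> (\<Sum>k\<in>{1..K}. measure (law A) (?E k))"
      using E by (intro A.finite_measure_subadditive_finite) auto
    also have "\<dots> = (\<Sum>k\<in>{1..K}. measure (?N k) (?Y k t))"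
      by (intro sum.cong refl measure_law_component(2) Y)
    finally show ?thesis .
  qed
  show ?thesis
  proof (rule summable_comparison_test_ev)
    show "summable (\<lambda>t. \<Sum>k\<in>{1..K}. real t ^ p * measure (?N k) (?Y k t))"
      by (intro summable_sum summ)
    show "\<forall>\<^sub>F t in sequentially. norm (real t ^ p * measure (law A) (llr_deviation I0 I1 \<F> A \<delta> t))
        \<le> (\<Sum>k\<in>{1..K}. real t ^ p * measure (?N k) (?Y k t))"
      using eventually_ge_at_top[of 1]
      by eventually_elim (use bound in \<open>auto simp: mult_left_mono simp flip: sum_distrib_left\<close>)
  qed
qed

section \<open>Every admissible test needs many observations\<close>

lemma sequential_test_events:
  assumes "(\<tau>, d) \<in> sequential_tests K S"
  shows "{\<omega> \<in> space (joint_space K S). \<tau> \<omega> \<le> u \<and> d \<omega> = y} \<in> sets (joint_filtration K S u)"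
    and "{\<omega> \<in> space (joint_space K S). \<tau> \<omega> \<le> u} \<in> sets (joint_filtration K S u)"
    and "{\<omega> \<in> space (joint_space K S). d \<omega> = y} \<in> sets (law A)"
proof -
  interpret filtration "space (joint_space K S)" "joint_filtration K S"
    by (rule filtration_joint_filtration)
  have \<tau>: "stopping_time (joint_filtration K S) \<tau>" and d: "d \<in> pre_sigma \<tau> \<rightarrow>\<^sub>M count_space UNIV"
    using assms by (auto simp: sequential_tests_def)
  have "d -` {y} \<inter> space (pre_sigma \<tau>) \<in> sets (pre_sigma \<tau>)"
    by (rule measurable_sets[OF d]) simp
  then have "{\<omega> \<in> d -` {y} \<inter> space (joint_space K S). \<tau> \<omega> \<le> v} \<in> sets (joint_filtration K S v)" for v
    unfolding space_pre_sigma by (rule sets_pre_sigmaD[OF \<tau>])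
  moreover have "{\<omega> \<in> d -` {y} \<inter> space (joint_space K S). \<tau> \<omega> \<le> v}
      = {\<omega> \<in> space (joint_space K S). \<tau> \<omega> \<le> v \<and> d \<omega> = y}" for v by auto
  ultimately have 1: "{\<omega> \<in> space (joint_space K S). \<tau> \<omega> \<le> v \<and> d \<omega> = y} \<in> sets (joint_filtration K S v)" for v
    by simp
  show "{\<omega> \<in> space (joint_space K S). \<tau> \<omega> \<le> u \<and> d \<omega> = y} \<in> sets (joint_filtration K S u)"
    by (rule 1)
  show "{\<omega> \<in> space (joint_space K S). \<tau> \<omega> \<le> u} \<in> sets (joint_filtration K S u)"
    using stopping_timeD[OF \<tau>, of u] by (simp add: pred_def space_F)
  show "{\<omega> \<in> space (joint_space K S). d \<omega> = y} \<in> sets (law A)"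
    using sets_law_filtration[OF 1[of \<infinity>]] by simp
qed

text \<open>
  Stopping by time \<open>N\<close> means deciding wrongly, which the error constraint makes rare, or deciding
  correctly by time \<open>N\<close>. The second event belongs to the observations up to the fixed time \<open>N\<close>, so the
  density at time \<open>N\<close> may be used on it: where that density costs at most \<open>exp c\<close>, the event is
  compared with its probability under the opposite hypothesis, where it is an error.
\<close>

lemma test_class_early_stopping:
  assumes F: "\<F> \<subseteq> Pow {1..K}" and A: "A \<in> \<F>" and N: "1 \<le> N"
    and test: "(\<tau>, d) \<in> test_class K S P0 P1 \<F> \<alpha> \<beta>"
  defines "E \<equiv> {\<omega> \<in> space (joint_space K S). \<tau> \<omega> \<le> enat N}"
  shows "measure (law {}) E \<le> \<alpha> + exp c * \<beta>
      + measure (law {}) {\<omega> \<in> space (joint_space K S). joint_llr K S P0 P1 A N \<omega> < - c}"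
    and "measure (law A) E \<le> \<beta> + exp c * \<alpha>
      + measure (law A) {\<omega> \<in> space (joint_space K S). c < joint_llr K S P0 P1 A N \<omega>}"
proof -
  interpret N: prob_space "law {}" by (rule prob_space_law)
  interpret A: prob_space "law A" by (rule prob_space_law)
  let ?\<Omega> = "space (joint_space K S)" and ?Z = "joint_llr K S P0 P1 A N"
  let ?F = "joint_filtration K S (enat N)"
  have AK: "A \<subseteq> {1..K}" using A F by auto
  have fin: "finite \<F>" using F by (rule finite_subset) simp
  have st: "(\<tau>, d) \<in> sequential_tests K S" using test by (simp add: test_class_def)
  note ev = sequential_test_events[OF st]
  have \<alpha>: "measure (law {}) {\<omega> \<in> ?\<Omega>. d \<omega> = Some H1} \<le> \<alpha>"
    using test by (simp add: test_class_def global_null_eq_law space_law)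
  have \<beta>: "measure (law A) {\<omega> \<in> ?\<Omega>. d \<omega> = Some H0} \<le> \<beta>"
  proof -
    have "measure (law A) {\<omega> \<in> ?\<Omega>. d \<omega> = Some H0}
        \<le> (MAX A\<in>\<F>. \<P>(\<omega> in law A. d \<omega> = Some H0))"
      using fin A by (intro Max_ge) (auto simp: space_law)
    also have "\<dots> \<le> \<beta>" using test by (simp add: test_class_def)
    finally show ?thesis .
  qed
  have split: "E \<subseteq> {\<omega> \<in> ?\<Omega>. d \<omega> = Some h} \<union> {\<omega> \<in> ?\<Omega>. \<tau> \<omega> \<le> enat N \<and> d \<omega> = Some h'}"
    if "h \<noteq> h'" for h h'
  proof
    fix \<omega> assume \<omega>: "\<omega> \<in> E"
    then have "d \<omega> \<noteq> None" using st by (auto simp: sequential_tests_def E_def)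
    then obtain g where "d \<omega> = Some g" by auto
    moreover have "g = h \<or> g = h'" using that by (cases g; cases h; cases h') auto
    ultimately show "\<omega> \<in> {\<omega> \<in> ?\<Omega>. d \<omega> = Some h} \<union> {\<omega> \<in> ?\<Omega>. \<tau> \<omega> \<le> enat N \<and> d \<omega> = Some h'}"
      using \<omega> by (auto simp: E_def)
  qed
  have Zm: "{\<omega> \<in> ?\<Omega>. P (?Z \<omega>)} \<in> sets ?F" if "Measurable.pred borel P" for P
    using measurable_compose[OF measurable_joint_llr that, of A N]
    by (simp add: pred_def space_joint_filtration)
  have Zlt: "{\<omega> \<in> ?\<Omega>. ?Z \<omega> < - c} \<in> sets (law C)" and Zgt: "{\<omega> \<in> ?\<Omega>. c < ?Z \<omega>} \<in> sets (law C)" for C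
    by (intro sets_law_filtration[OF Zm]; measurable)+
  show "measure (law {}) E \<le> \<alpha> + exp c * \<beta> + measure (law {}) {\<omega> \<in> ?\<Omega>. ?Z \<omega> < - c}"
  proof -
    let ?D = "{\<omega> \<in> ?\<Omega>. \<tau> \<omega> \<le> enat N \<and> d \<omega> = Some H0}"
    let ?G = "?D \<inter> {\<omega> \<in> ?\<Omega>. - c \<le> ?Z \<omega>}"
    have G: "?G \<in> sets ?F" by (intro sets.Int ev Zm) measurable
    have "measure (law {}) E \<le> measure (law {})
        ({\<omega> \<in> ?\<Omega>. d \<omega> = Some H1} \<union> (?G \<union> {\<omega> \<in> ?\<Omega>. ?Z \<omega> < - c}))"
      using split[of H1 H0] G by (intro N.finite_measure_mono sets.Un ev(3) Zlt sets_law_filtration[OF G]) auto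
    also have "\<dots> \<le> measure (law {}) {\<omega> \<in> ?\<Omega>. d \<omega> = Some H1}
        + (measure (law {}) ?G + measure (law {}) {\<omega> \<in> ?\<Omega>. ?Z \<omega> < - c})"
      by (intro order_trans[OF measure_Un_le] add_left_mono
          measure_Un_le sets.Un ev(3) Zlt sets_law_filtration[OF G])
    also have "measure (law {}) ?G \<le> exp (- (- c)) * measure (law A) ?G"
      by (rule null_le_law[OF AK N G]) auto
    also have "measure (law A) ?G \<le> measure (law A) {\<omega> \<in> ?\<Omega>. d \<omega> = Some H0}"
      by (intro A.finite_measure_mono ev(3)) auto
    also note \<alpha>
    also note \<beta>
    finally show ?thesis by simp
  qed
  show "measure (law A) E \<le> \<beta> + exp c * \<alpha> + measure (law A) {\<omega> \<in> ?\<Omega>. c < ?Z \<omega>}"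
  proof -
    let ?D = "{\<omega> \<in> ?\<Omega>. \<tau> \<omega> \<le> enat N \<and> d \<omega> = Some H1}"
    let ?G = "?D \<inter> {\<omega> \<in> ?\<Omega>. ?Z \<omega> \<le> c}"
    have G: "?G \<in> sets ?F" by (intro sets.Int ev Zm) measurable
    have "measure (law A) E \<le> measure (law A)
        ({\<omega> \<in> ?\<Omega>. d \<omega> = Some H0} \<union> (?G \<union> {\<omega> \<in> ?\<Omega>. c < ?Z \<omega>}))"
      using split[of H0 H1] G by (intro A.finite_measure_mono sets.Un ev(3) Zgt sets_law_filtration[OF G]) auto
    also have "\<dots> \<le> measure (law A) {\<omega> \<in> ?\<Omega>. d \<omega> = Some H0}
        + (measure (law A) ?G + measure (law A) {\<omega> \<in> ?\<Omega>. c < ?Z \<omega>})"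
      by (intro order_trans[OF measure_Un_le] add_left_mono
          measure_Un_le sets.Un ev(3) Zgt sets_law_filtration[OF G])
    also have "measure (law A) ?G \<le> exp c * measure (law {}) ?G"
      by (rule law_le_null[OF AK N G]) auto
    also have "measure (law {}) ?G \<le> measure (law {}) {\<omega> \<in> ?\<Omega>. d \<omega> = Some H1}"
      by (intro N.finite_measure_mono ev(3)) auto
    also note \<alpha>
    also note \<beta>
    finally show ?thesis by simp
  qed
qed

end

section \<open>Moments of an integer-valued time\<close>

text \<open>
  The mean value theorem bounds the increment by \<open>q z\<^bsup>q-1\<^esup>\<close> with \<open>z \<le> m + 1 \<le> 2 m\<close>, which is where
  the constant \<open>q 2\<^bsup>r-1\<^esup>\<close> comes from.
\<close>

lemma powr_Suc_le:
  fixes q :: real and r m :: nat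
  assumes "1 \<le> q" "q \<le> real r" "1 \<le> m"
  shows "real (Suc m) powr q \<le> real m powr q + q * 2 ^ (r - 1) * real m ^ (r - 1)"
proof -
  have "\<exists>z. real m < z \<and> z < real (Suc m) \<and>
      real (Suc m) powr q - real m powr q = (real (Suc m) - real m) * (q * z powr (q - 1))"
    using assms by (intro MVT2) (auto intro!: derivative_eq_intros simp: powr_diff)
  then obtain z where z: "real m < z" "z < real (Suc m)"
      "real (Suc m) powr q - real m powr q = q * z powr (q - 1)" by auto
  have "z powr (q - 1) \<le> z powr (real (r - 1))"
    using z assms by (intro powr_mono) auto
  also have "\<dots> = z ^ (r - 1)" using z by (simp add: powr_realpow)
  also have "\<dots> \<le> (2 * real m) ^ (r - 1)" using z assms by (intro power_mono) auto
  also have "\<dots> = 2 ^ (r - 1) * real m ^ (r - 1)" by (rule power_mult_distrib)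
  finally have "q * z powr (q - 1) \<le> q * (2 ^ (r - 1) * real m ^ (r - 1))"
    using assms by (intro mult_left_mono) auto
  with z(3) show ?thesis by simp
qed

lemma powr_le_sum:
  fixes q :: real and r m N :: nat
  assumes q: "1 \<le> q" "q \<le> real r" and N: "1 \<le> N"
  shows "real (N + j) powr q \<le> real N powr q + (\<Sum>n<j. q * 2 ^ (r - 1) * real (n + N) ^ (r - 1))"
proof (induction j)
  case (Suc j)
  have "real (Suc (j + N)) powr q \<le> real (j + N) powr q + q * 2 ^ (r - 1) * real (j + N) ^ (r - 1)"
    by (rule powr_Suc_le) (use q N in auto)
  with Suc show ?case by (simp add: add.commute)
qed simp

text \<open>
  Telescoping \<open>m\<^sup>q\<close> from \<open>N\<close> on. An infinite \<open>T\<close> is covered, since then all terms of the series are at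
  least \<open>1\<close>.
\<close>

lemma enat_powr_le_suminf:
  fixes q :: real and r N :: nat
  assumes q: "1 \<le> q" "q \<le> real r" and N: "1 \<le> N"
  shows "enat_powr T q \<le> ennreal (real N powr q)
    + (\<Sum>n. ennreal (q * 2 ^ (r - 1) * real (n + N) ^ (r - 1)) * indicator {n. enat (n + N) < T} n)"
    (is "_ \<le> _ + suminf ?f")
proof (cases T)
  case (enat m)
  show ?thesis
  proof (cases "m \<le> N")
    case True
    then have "enat_powr T q \<le> ennreal (real N powr q) + 0"
      using q by (auto simp: enat enat_powr_def intro!: ennreal_leI powr_mono2)
    also have "\<dots> \<le> ennreal (real N powr q) + suminf ?f" by (intro add_left_mono) simp
    finally show ?thesis .
  next
    case False
    let ?g = "\<lambda>n. q * 2 ^ (r - 1) * real (n + N) ^ (r - 1)"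
    have "enat_powr T q = ennreal (real (N + (m - N)) powr q)"
      using False by (simp add: enat enat_powr_def)
    also have "\<dots> \<le> ennreal (real N powr q + sum ?g {..<m - N})"
      by (intro ennreal_leI powr_le_sum q N)
    also have "\<dots> = ennreal (real N powr q) + (\<Sum>n<m - N. ennreal (?g n))"
      using q by (subst ennreal_plus) (auto simp: sum_nonneg sum_ennreal)
    also have "(\<Sum>n<m - N. ennreal (?g n)) = (\<Sum>n<m - N. ?f n)"
      by (intro sum.cong) (auto simp: enat indicator_def)
    also have "\<dots> \<le> suminf ?f"
      by (intro sum_le_suminf) auto
    finally show ?thesis by (simp add: add_left_mono)
  qed
next
  case infinity
  have ge1: "1 \<le> ?f n" for n
  proof -
    have "1 * 1 * 1 \<le> q * 2 ^ (r - 1) * real (n + N) ^ (r - 1)"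
      using q N by (intro mult_mono one_le_power) auto
    then have "ennreal 1 \<le> ennreal (q * 2 ^ (r - 1) * real (n + N) ^ (r - 1))"
      by (intro ennreal_leI) simp
    then show ?thesis by (simp add: infinity)
  qed
  have "of_nat j \<le> suminf ?f" for j
  proof -
    have "of_nat j = (\<Sum>n<j. 1 :: ennreal)" by simp
    also have "\<dots> \<le> (\<Sum>n<j. ?f n)" by (intro sum_mono ge1)
    also have "\<dots> \<le> suminf ?f" by (intro sum_le_suminf) auto
    finally show ?thesis .
  qed
  then have "suminf ?f = top"
    by (meson ennreal_Ex_less_of_nat leD top.not_eq_extremum)
  then show ?thesis by simp
qed

text \<open>
  If surviving time \<open>n\<close> forces \<open>B n\<close> for all \<open>n \<ge> N\<close>, the moment exceeds \<open>N\<^sup>q\<close> by at most a quantity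
  that does not depend on \<open>N\<close>. This is what keeps the leading term sharp.
\<close>

lemma nn_integral_enat_powr_le:
  fixes q :: real and r N :: nat
  assumes M: "prob_space M" and q: "1 \<le> q" "q \<le> real r" and N: "1 \<le> N"
    and B: "\<And>n. B n \<in> sets M"
    and T: "\<And>n \<omega>. N \<le> n \<Longrightarrow> \<omega> \<in> space M \<Longrightarrow> enat n < T \<omega> \<Longrightarrow> \<omega> \<in> B n"
    and sumB: "summable (\<lambda>n. real n ^ (r - 1) * measure M (B n))"
  shows "(\<integral>\<^sup>+\<omega>. enat_powr (T \<omega>) q \<partial>M)
    \<le> ennreal (real N powr q + q * 2 ^ (r - 1) * (\<Sum>n. real n ^ (r - 1) * measure M (B n)))"
proof -
  interpret prob_space M by fact
  let ?c = "q * 2 ^ (r - 1)"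
  let ?p = "\<lambda>n. real n ^ (r - 1) * measure M (B n)"
  have c: "0 \<le> ?c" using q by simp
  have shift: "summable (\<lambda>n. ?p (n + N))"
    using sumB summable_iff_shift[of ?p N] by blast
  have "(\<integral>\<^sup>+\<omega>. enat_powr (T \<omega>) q \<partial>M)
      \<le> (\<integral>\<^sup>+\<omega>. ennreal (real N powr q)
          + (\<Sum>n. ennreal (?c * real (n + N) ^ (r - 1)) * indicator (B (n + N)) \<omega>) \<partial>M)"
  proof (rule nn_integral_mono)
    fix \<omega> assume \<omega>: "\<omega> \<in> space M"
    show "enat_powr (T \<omega>) q \<le> ennreal (real N powr q)
          + (\<Sum>n. ennreal (?c * real (n + N) ^ (r - 1)) * indicator (B (n + N)) \<omega>)"
      by (rule order_trans[OF enat_powr_le_suminf[OF q N]])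
         (use T \<omega> in \<open>auto intro!: add_left_mono suminf_le mult_left_mono simp: indicator_def\<close>)
  qed
  also have "\<dots> = ennreal (real N powr q)
      + (\<Sum>n. ennreal (?c * real (n + N) ^ (r - 1)) * emeasure M (B (n + N)))"
    using B by (simp add: nn_integral_add nn_integral_suminf nn_integral_cmult emeasure_space_1)
  also have "(\<Sum>n. ennreal (?c * real (n + N) ^ (r - 1)) * emeasure M (B (n + N)))
      = (\<Sum>n. ennreal (?c * ?p (n + N)))"
  proof (rule suminf_cong)
    fix n
    have "ennreal (?c * real (n + N) ^ (r - 1)) * emeasure M (B (n + N))
        = ennreal ((?c * real (n + N) ^ (r - 1)) * measure M (B (n + N)))"
      unfolding emeasure_eq_measure using c by (intro ennreal_mult[symmetric]) auto
    then show "ennreal (?c * real (n + N) ^ (r - 1)) * emeasure M (B (n + N)) = ennreal (?c * ?p (n + N))"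
      by (simp only: mult.assoc)
  qed
  also have "\<dots> = ennreal (\<Sum>n. ?c * ?p (n + N))"
  proof (rule suminf_ennreal2)
    show "summable (\<lambda>n. ?c * ?p (n + N))"
      by (rule summable_mult[OF shift])
  qed (use c in auto)
  also have "ennreal (real N powr q) + ennreal (\<Sum>n. ?c * ?p (n + N))
      = ennreal (real N powr q + (\<Sum>n. ?c * ?p (n + N)))"
    using c by (intro ennreal_plus[symmetric] suminf_nonneg summable_mult[OF shift]) auto
  also have "\<dots> \<le> ennreal (real N powr q + ?c * suminf ?p)"
  proof (intro ennreal_leI add_left_mono)
    have "(\<Sum>n. ?c * ?p (n + N)) = ?c * (\<Sum>n. ?p (n + N))"
      by (rule suminf_mult[OF shift])
    also have "(\<Sum>n. ?p (n + N)) \<le> suminf ?p"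
      using suminf_split_initial_segment[OF sumB, of N] by (simp add: sum_nonneg)
    finally show "(\<Sum>n. ?c * ?p (n + N)) \<le> ?c * suminf ?p"
      using c by (simp add: mult_left_mono)
  qed
  finally show ?thesis .
qed

lemma nn_integral_enat_powr_ge:
  fixes q x :: real and N :: nat
  assumes M: "prob_space M" and q: "0 \<le> q" and x: "0 \<le> x" "x \<le> real (Suc N)"
    and T: "{\<omega> \<in> space M. T \<omega> \<le> enat N} \<in> sets M"
  shows "ennreal (x powr q * (1 - measure M {\<omega> \<in> space M. T \<omega> \<le> enat N}))
    \<le> (\<integral>\<^sup>+\<omega>. enat_powr (T \<omega>) q \<partial>M)"
proof -
  interpret prob_space M by fact
  let ?E = "{\<omega> \<in> space M. T \<omega> \<le> enat N}"
  have "ennreal (x powr q * (1 - measure M ?E)) = ennreal (x powr q) * emeasure M (space M - ?E)"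
    using T by (simp add: emeasure_eq_measure prob_compl ennreal_mult)
  also have "\<dots> = (\<integral>\<^sup>+\<omega>. ennreal (x powr q) * indicator (space M - ?E) \<omega> \<partial>M)"
    using T by (intro nn_integral_cmult_indicator[symmetric]) auto
  also have "\<dots> \<le> (\<integral>\<^sup>+\<omega>. enat_powr (T \<omega>) q \<partial>M)"
  proof (intro nn_integral_mono)
    fix \<omega> assume "\<omega> \<in> space M"
    show "ennreal (x powr q) * indicator (space M - ?E) \<omega> \<le> enat_powr (T \<omega>) q"
    proof (cases "\<omega> \<in> space M - ?E")
      case True
      show ?thesis
      proof (cases "T \<omega>")
        case (enat m)
        with True have "Suc N \<le> m" by auto
        then have "real (Suc N) \<le> real m" by (simp only: of_nat_le_iff)
        with x have "x \<le> real m" by linarith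
        then show ?thesis using True x q
          by (auto simp: enat_powr_def enat intro!: ennreal_leI powr_mono2)
      qed (simp add: enat_powr_def)
    qed auto
  qed
  finally show ?thesis .
qed

section \<open>From bounds on moments to asymptotic equivalence\<close>

lemma eventually_error_limit_range:
  "\<forall>\<^sub>F (\<alpha>, \<beta>) in error_limit. 0 < \<alpha> \<and> \<alpha> < 1 \<and> 0 < \<beta> \<and> \<beta> < 1"
  unfolding eventually_error_limit by (intro exI[of _ 1]) auto

lemma error_limit_tendsto_0:
  "((\<lambda>(\<alpha>, \<beta>). \<alpha>) \<longlongrightarrow> 0) error_limit" "((\<lambda>(\<alpha>, \<beta>). \<beta>) \<longlongrightarrow> 0) error_limit"
  unfolding tendsto_iff dist_real_def eventually_error_limit by auto

lemma filterlim_abs_ln_error_limit: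
  "filterlim (\<lambda>(\<alpha>, \<beta>). \<bar>ln \<alpha>\<bar>) at_top error_limit" "filterlim (\<lambda>(\<alpha>, \<beta>). \<bar>ln \<beta>\<bar>) at_top error_limit"
proof -
  have "Z \<le> \<bar>ln x\<bar>" if "0 < x" "x < exp (- Z)" for x Z :: real
    using that ln_less_cancel_iff[of x "exp (- Z)"] by simp
  then have "\<forall>\<alpha> \<beta>. 0 < \<alpha> \<and> \<alpha> < 1 \<and> 0 < \<beta> \<and> \<beta> < 1 \<and> max \<alpha> \<beta> < exp (- Z)
      \<longrightarrow> Z \<le> \<bar>ln \<alpha>\<bar> \<and> Z \<le> \<bar>ln \<beta>\<bar>" for Z :: real
    by (simp only: max_less_iff_conj) blast
  then have ev: "\<forall>\<^sub>F (\<alpha>, \<beta>) in error_limit. Z \<le> \<bar>ln \<alpha>\<bar> \<and> Z \<le> \<bar>ln \<beta>\<bar>" for Z :: real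
    unfolding eventually_error_limit by (intro exI[of _ "exp (- Z)"]) simp
  show "filterlim (\<lambda>(\<alpha>, \<beta>). \<bar>ln \<alpha>\<bar>) at_top error_limit"
    unfolding filterlim_at_top by (intro allI eventually_mono[OF ev]) auto
  show "filterlim (\<lambda>(\<alpha>, \<beta>). \<bar>ln \<beta>\<bar>) at_top error_limit"
    unfolding filterlim_at_top by (intro allI eventually_mono[OF ev]) auto
qed

text \<open>
  The upper bound divided by the claimed asymptotic value: additive constants disappear in the limit
  and only the loss of \<open>\<epsilon>\<close> in the drift remains.
\<close>

lemma tendsto_affine_powr_ratio:
  fixes c C m \<epsilon> q :: real
  assumes q: "1 \<le> q" and \<epsilon>: "0 < \<epsilon>" "\<epsilon> < m"
  shows "((\<lambda>l. (((l + c) / (m - \<epsilon>) + 2) powr q + C) / (l / m) powr q) \<longlongrightarrow> (m / (m - \<epsilon>)) powr q) at_top"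
proof -
  have m: "0 < m" using \<epsilon> by simp
  let ?d = "m * (c + 2 * (m - \<epsilon>)) / (m - \<epsilon>)"
  have inv: "((\<lambda>l::real. inverse l) \<longlongrightarrow> 0) at_top"
    by (rule tendsto_inverse_0_at_top[OF filterlim_ident])
  have 1: "((\<lambda>l. (m / (m - \<epsilon>) + ?d * inverse l) powr q) \<longlongrightarrow> (m / (m - \<epsilon>) + ?d * 0) powr q) at_top"
    using \<epsilon> m by (intro tendsto_intros inv) auto
  have "filterlim (\<lambda>l. l / m) at_top at_top"
    using m by (intro filterlim_at_top_mult_tendsto_pos[OF tendsto_const _ filterlim_ident, of "1 / m", simplified]) simp
  then have "filterlim (\<lambda>l. (l / m) powr q) at_top at_top"
  proof (rule filterlim_at_top_mono)
    show "\<forall>\<^sub>F l in at_top. l / m \<le> (l / m) powr q"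
      using eventually_ge_at_top[of m]
    proof eventually_elim
      case (elim l)
      then have "1 \<le> l / m" using m by simp
      then show ?case using powr_mono[OF q, of "l / m"] powr_one[of "l / m"] by linarith
    qed
  qed
  then have 2: "((\<lambda>l. C / (l / m) powr q) \<longlongrightarrow> 0) at_top"
    by (intro tendsto_divide_0[OF tendsto_const] filterlim_at_top_imp_at_infinity)
  have "((\<lambda>l. (m / (m - \<epsilon>) + ?d * inverse l) powr q + C / (l / m) powr q)
      \<longlongrightarrow> (m / (m - \<epsilon>) + ?d * 0) powr q + 0) at_top"
    by (intro tendsto_add 1 2)
  then have lim: "((\<lambda>l. (m / (m - \<epsilon>) + ?d * inverse l) powr q + C / (l / m) powr q)
      \<longlongrightarrow> (m / (m - \<epsilon>)) powr q) at_top" by simp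
  show ?thesis
  proof (rule Lim_transform_eventually[OF lim])
    show "\<forall>\<^sub>F l in at_top. (m / (m - \<epsilon>) + ?d * inverse l) powr q + C / (l / m) powr q
        = (((l + c) / (m - \<epsilon>) + 2) powr q + C) / (l / m) powr q"
      using eventually_gt_at_top[of "max 0 (- c)"]
    proof eventually_elim
      case (elim l)
      then have l: "0 < l" "0 < l + c" by auto
      have "m / e + m * (c + 2 * e) / e * inverse l = ((l + c) / e + 2) / (l / m)" if "0 < e" for e
        using that l m by (simp add: field_simps)
      from this[of "m - \<epsilon>"] have "m / (m - \<epsilon>) + ?d * inverse l = ((l + c) / (m - \<epsilon>) + 2) / (l / m)"
        using \<epsilon> by simp
      then have "(m / (m - \<epsilon>) + ?d * inverse l) powr q = ((l + c) / (m - \<epsilon>) + 2) powr q / (l / m) powr q"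
        by (simp only: powr_divide)
      then show ?case by (simp add: add_divide_distrib)
    qed
  qed
qed

text \<open>
  Here \<open>J\<close> is the infimum over all tests and \<open>G\<close> the moment of one of them. The losses \<open>\<epsilon>\<close> in both
  bounds are arbitrary, so both ratios to the claimed value tend to \<open>1\<close>. The shift \<open>c\<close> absorbs the
  logarithm of the number of patterns in the upper threshold.
\<close>

lemma ennreal_asymp_equiv_sandwich:
  fixes G J :: "'b \<Rightarrow> ennreal" and L :: "'b \<Rightarrow> real" and m q c :: real
  assumes L: "filterlim L at_top F" and m: "0 < m" and q: "1 \<le> q"
    and upper: "\<And>\<epsilon>. 0 < \<epsilon> \<Longrightarrow> \<epsilon> < m \<Longrightarrow>
      \<exists>C. \<forall>\<^sub>F x in F. G x \<le> ennreal (((L x + c) / (m - \<epsilon>) + 2) powr q + C)"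
    and lower: "\<And>\<epsilon>. 0 < \<epsilon> \<Longrightarrow> \<epsilon> < 1 \<Longrightarrow>
      \<exists>p. (p \<longlongrightarrow> 0) F \<and> (\<forall>\<^sub>F x in F. ennreal (((1 - \<epsilon>) * (L x / m)) powr q * (1 - p x)) \<le> J x)"
    and JG: "\<forall>\<^sub>F x in F. J x \<le> G x"
  shows "ennreal_asymp_equiv G F (\<lambda>x. ennreal ((L x / m) powr q)) \<and>
    ennreal_asymp_equiv (\<lambda>x. ennreal ((L x / m) powr q)) F J"
proof -
  let ?g = "\<lambda>x. (L x / m) powr q"
  have Lpos: "\<forall>\<^sub>F x in F. 0 < L x"
    using L by (simp add: filterlim_at_top_dense)
  have JG': "\<forall>\<^sub>F x in F. J x / ennreal (?g x) \<le> G x / ennreal (?g x)"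
    using JG by eventually_elim (rule divide_right_mono_ennreal)
  have low: "\<forall>\<^sub>F x in F. y < J x / ennreal (?g x)" if y: "y < 1" for y
  proof -
    have "((\<lambda>\<epsilon>. ennreal ((1 - \<epsilon>) powr q)) \<longlongrightarrow> ennreal ((1 - 0) powr q)) (at_right 0)"
      by (intro tendsto_intros) auto
    from order_tendstoD(1)[OF this, of y] y have "\<forall>\<^sub>F \<epsilon> in at_right 0. y < ennreal ((1 - \<epsilon>) powr q)" by simp
    moreover have "\<forall>\<^sub>F \<epsilon> in at_right (0::real). \<epsilon> \<in> {0<..<1}" by (rule eventually_at_right_real) simp
    ultimately have "\<forall>\<^sub>F \<epsilon> in at_right 0. y < ennreal ((1 - \<epsilon>) powr q) \<and> \<epsilon> \<in> {0<..<1}"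
      by (rule eventually_conj)
    from eventually_happens[OF this] obtain \<epsilon> where \<epsilon>: "y < ennreal ((1 - \<epsilon>) powr q)" "0 < \<epsilon>" "\<epsilon> < 1"
      by auto
    obtain p where p: "(p \<longlongrightarrow> 0) F"
      and J: "\<forall>\<^sub>F x in F. ennreal (((1 - \<epsilon>) * (L x / m)) powr q * (1 - p x)) \<le> J x"
      using lower[OF \<epsilon>(2,3)] by blast
    have "((\<lambda>x. ennreal ((1 - \<epsilon>) powr q * (1 - p x))) \<longlongrightarrow> ennreal ((1 - \<epsilon>) powr q * (1 - 0))) F"
      by (intro tendsto_intros p)
    from order_tendstoD(1)[OF this, of y] \<epsilon>(1)
    have "\<forall>\<^sub>F x in F. y < ennreal ((1 - \<epsilon>) powr q * (1 - p x))" by simp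
    moreover have "\<forall>\<^sub>F x in F. p x < 1" by (rule order_tendstoD(2)[OF p]) simp
    ultimately show ?thesis using J Lpos
    proof eventually_elim
      case (elim x)
      have "((1 - \<epsilon>) * (L x / m)) powr q = (1 - \<epsilon>) powr q * ?g x"
        using \<epsilon> m elim by (intro powr_mult)
      then have "ennreal (((1 - \<epsilon>) * (L x / m)) powr q * (1 - p x)) / ennreal (?g x)
          = ennreal ((1 - \<epsilon>) powr q * (1 - p x))"
        using m elim by (subst divide_ennreal) auto
      then show ?case
        using elim divide_right_mono_ennreal[OF elim(3), of "ennreal (?g x)"] by simp
    qed
  qed
  have up: "\<forall>\<^sub>F x in F. G x / ennreal (?g x) < y" if y: "1 < y" for y
  proof -
    have "((\<lambda>\<epsilon>. ennreal ((m / (m - \<epsilon>)) powr q)) \<longlongrightarrow> ennreal ((m / (m - 0)) powr q)) (at_right 0)"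
      using m by (intro tendsto_intros) auto
    from order_tendstoD(2)[OF this, of y] y m
    have "\<forall>\<^sub>F \<epsilon> in at_right 0. ennreal ((m / (m - \<epsilon>)) powr q) < y" by simp
    moreover have "\<forall>\<^sub>F \<epsilon> in at_right (0::real). \<epsilon> \<in> {0<..<m}" by (rule eventually_at_right_real) (rule m)
    ultimately have "\<forall>\<^sub>F \<epsilon> in at_right 0. ennreal ((m / (m - \<epsilon>)) powr q) < y \<and> \<epsilon> \<in> {0<..<m}"
      by (rule eventually_conj)
    from eventually_happens[OF this] obtain \<epsilon> where \<epsilon>: "ennreal ((m / (m - \<epsilon>)) powr q) < y" "0 < \<epsilon>" "\<epsilon> < m"
      by auto
    obtain C where G: "\<forall>\<^sub>F x in F. G x \<le> ennreal (((L x + c) / (m - \<epsilon>) + 2) powr q + C)"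
      using upper[OF \<epsilon>(2,3)] by blast
    let ?C = "max C 0"
    have "((\<lambda>x. ennreal ((((L x + c) / (m - \<epsilon>) + 2) powr q + ?C) / (L x / m) powr q))
        \<longlongrightarrow> ennreal ((m / (m - \<epsilon>)) powr q)) F"
      by (intro tendsto_ennrealI filterlim_compose[OF tendsto_affine_powr_ratio[OF q \<epsilon>(2,3)] L])
    from order_tendstoD(2)[OF this \<epsilon>(1)] G Lpos
    show ?thesis
    proof eventually_elim
      case (elim x)
      let ?u = "((L x + c) / (m - \<epsilon>) + 2) powr q"
      have "G x \<le> ennreal (?u + ?C)"
        using elim(2) by (rule order_trans) (intro ennreal_leI, simp)
      then have "G x / ennreal (?g x) \<le> ennreal (?u + ?C) / ennreal (?g x)"
        by (rule divide_right_mono_ennreal)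
      also have "\<dots> = ennreal ((?u + ?C) / ?g x)"
        using elim m by (intro divide_ennreal) auto
      finally show ?case using elim(1) by simp
    qed
  qed
  have J: "((\<lambda>x. J x / ennreal (?g x)) \<longlongrightarrow> 1) F"
  proof (rule order_tendstoI)
    show "\<forall>\<^sub>F x in F. J x / ennreal (?g x) < y" if "1 < y" for y
      using up[OF that] JG' by eventually_elim (rule le_less_trans)
  qed (rule low)
  have "ennreal_asymp_equiv G F (\<lambda>x. ennreal (?g x))"
    unfolding ennreal_asymp_equiv_def
  proof (rule order_tendstoI)
    show "\<forall>\<^sub>F x in F. y < G x / ennreal (?g x)" if "y < 1" for y
      using low[OF that] JG' by eventually_elim (rule less_le_trans)
  qed (rule up)
  \<comment> \<open>The second equivalence has \<open>J\<close> in the denominator, so the limit is inverted.\<close>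
  moreover have "ennreal_asymp_equiv (\<lambda>x. ennreal (?g x)) F J"
  proof -
    have "((\<lambda>x. inverse (J x / ennreal (?g x))) \<longlongrightarrow> inverse 1) F"
      by (rule continuous_on_tendsto_compose[OF continuous_on_inverse_ennreal[OF continuous_on_id[of UNIV]] J]) auto
    moreover have "inverse 1 = (1 :: ennreal)" using inverse_ennreal[of 1] by simp
    ultimately have lim: "((\<lambda>x. inverse (J x / ennreal (?g x))) \<longlongrightarrow> 1) F" by (simp only:)
    have "\<forall>\<^sub>F x in F. inverse (J x / ennreal (?g x)) = ennreal (?g x) / J x"
      using Lpos
    proof eventually_elim
      case (elim x)
      then have g: "0 < ?g x" using m by simp
      show ?case
      proof (cases "J x")
        case (real j)
        show ?thesis
        proof (cases "j = 0")
          case True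
          with real g show ?thesis by simp
        next
          case False
          with real g show ?thesis by (simp add: divide_ennreal inverse_ennreal)
        qed
      qed (use g in \<open>simp add: ennreal_top_divide\<close>)
    qed
    from Lim_transform_eventually[OF lim this]
    show ?thesis
      unfolding ennreal_asymp_equiv_def .
  qed
  ultimately show ?thesis ..
qed

section \<open>Upper and lower bounds on the moments of the stopping times\<close>

context multichannel_model
begin

text \<open>
  Beyond \<open>h / (m - \<delta>)\<close> the drift line lowered by \<open>\<delta> t\<close> has passed the threshold \<open>h\<close>. The constant \<open>C\<close>
  is chosen before \<open>T\<close> and \<open>h\<close>: it must not grow with the thresholds of the test.
\<close>

lemma nn_integral_stopping_time_le:
  fixes q \<delta> :: real
  assumes F: "finite \<F>" and q: "1 \<le> q" "q \<le> real r" and \<delta>: "\<delta> < m"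
    and dev: "summable (\<lambda>t. real t ^ (r - 1) * measure (law A) (llr_deviation I0 I1 \<F> A \<delta> t))"
  obtains C where "\<And>T h. 0 \<le> h \<Longrightarrow>
    (\<And>t \<omega>. \<omega> \<in> space (joint_space K S) \<Longrightarrow> 1 \<le> t \<Longrightarrow> h \<le> real t * (m - \<delta>) \<Longrightarrow>
       \<omega> \<notin> llr_deviation I0 I1 \<F> A \<delta> t \<Longrightarrow> T \<omega> \<le> enat t) \<Longrightarrow>
    (\<integral>\<^sup>+\<omega>. enat_powr (T \<omega>) q \<partial>law A) \<le> ennreal ((h / (m - \<delta>) + 2) powr q + C)"
proof
  let ?C = "q * 2 ^ (r - 1) * (\<Sum>t. real t ^ (r - 1) * measure (law A) (llr_deviation I0 I1 \<F> A \<delta> t))"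
  fix T h assume h: "(0::real) \<le> h"
    and T: "\<And>t \<omega>. \<omega> \<in> space (joint_space K S) \<Longrightarrow> 1 \<le> t \<Longrightarrow> h \<le> real t * (m - \<delta>) \<Longrightarrow>
       \<omega> \<notin> llr_deviation I0 I1 \<F> A \<delta> t \<Longrightarrow> T \<omega> \<le> enat t"
  \<comment> \<open>The extra \<open>1\<close> keeps \<open>N\<close> positive when \<open>h = 0\<close>.\<close>
  define N where "N = nat \<lceil>h / (m - \<delta>)\<rceil> + 1"
  have N: "1 \<le> N" "h / (m - \<delta>) \<le> real N" "real N \<le> h / (m - \<delta>) + 2"
    using h \<delta> by (auto simp: N_def, linarith+)
  have "(\<integral>\<^sup>+\<omega>. enat_powr (T \<omega>) q \<partial>law A) \<le> ennreal (real N powr q + ?C)"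
  proof (rule nn_integral_enat_powr_le[OF prob_space_law q N(1) sets_llr_deviation[OF F] _ dev])
    fix t \<omega> assume t: "N \<le> t" "\<omega> \<in> space (law A)" "enat t < T \<omega>"
    have "h / (m - \<delta>) \<le> real t" using N(2) t(1) by linarith
    then have "h \<le> real t * (m - \<delta>)" using \<delta> by (simp add: pos_divide_le_eq)
    with T[of \<omega> t] t N(1) show "\<omega> \<in> llr_deviation I0 I1 \<F> A \<delta> t"
      by (auto simp: space_law not_le[symmetric])
  qed
  also have "\<dots> \<le> ennreal ((h / (m - \<delta>) + 2) powr q + ?C)"
    using N(3) q by (intro ennreal_leI add_right_mono powr_mono2) auto
  finally show "(\<integral>\<^sup>+\<omega>. enat_powr (T \<omega>) q \<partial>law A) \<le> \<dots>" .
qed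

text \<open>
  With \<open>N\<close> about \<open>(1 - \<epsilon>) L / m\<close> and \<open>c = (1 - \<epsilon>\<^sup>2) L\<close>, the level \<open>c\<close> lies above the drift \<open>m N\<close> by
  the factor \<open>1 + \<epsilon>\<close>, while the cost \<open>exp (c - L) = exp (- \<epsilon>\<^sup>2 L)\<close> still vanishes. The error term \<open>p\<close>
  does not depend on the test, which makes the bound pass to the infimum.
\<close>

lemma nn_integral_test_class_ge:
  fixes q m \<epsilon> :: real
  assumes q: "0 \<le> q" and m: "0 < m" and \<epsilon>: "0 < \<epsilon>" "\<epsilon> < 1"
    and dev: "(\<lambda>t. measure (law A) (llr_deviation I0 I1 \<F> A (\<epsilon> * m) t)) \<longlonglongrightarrow> 0"
    and L: "filterlim L at_top error_limit" and \<gamma>: "(\<gamma> \<longlongrightarrow> 0) error_limit"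
    and early: "\<And>\<alpha> \<beta> N c \<tau> d. 0 < \<alpha> \<Longrightarrow> \<alpha> < 1 \<Longrightarrow> 0 < \<beta> \<Longrightarrow> \<beta> < 1 \<Longrightarrow> 1 \<le> N \<Longrightarrow>
      (1 + \<epsilon>) * m * real N \<le> c \<Longrightarrow> (\<tau>, d) \<in> test_class K S P0 P1 \<F> \<alpha> \<beta> \<Longrightarrow>
      measure (law A) {\<omega> \<in> space (joint_space K S). \<tau> \<omega> \<le> enat N}
        \<le> \<gamma> (\<alpha>, \<beta>) + exp (c - L (\<alpha>, \<beta>)) + measure (law A) (llr_deviation I0 I1 \<F> A (\<epsilon> * m) N)"
  shows "\<exists>p. (p \<longlongrightarrow> 0) error_limit \<and> (\<forall>\<^sub>F x in error_limit.
    ennreal (((1 - \<epsilon>) * (L x / m)) powr q * (1 - p x))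
      \<le> (case x of (\<alpha>, \<beta>) \<Rightarrow> INF (\<tau>, d)\<in>test_class K S P0 P1 \<F> \<alpha> \<beta>.
            \<integral>\<^sup>+\<omega>. enat_powr (\<tau> \<omega>) q \<partial>law A))"
proof -
  define N where "N x = nat \<lfloor>(1 - \<epsilon>) * (L x / m)\<rfloor>" for x
  define p where "p x = \<gamma> x + exp (- (\<epsilon>\<^sup>2 * L x))
      + measure (law A) (llr_deviation I0 I1 \<F> A (\<epsilon> * m) (N x))" for x
  have Lm: "filterlim (\<lambda>x. (1 - \<epsilon>) * (L x / m)) at_top error_limit"
    using filterlim_tendsto_pos_mult_at_top[OF tendsto_const _ L, of "(1 - \<epsilon>) / m"] \<epsilon> m by simp
  have N: "filterlim N at_top error_limit"
    unfolding N_def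
    by (rule filterlim_compose[OF filterlim_nat_sequentially filterlim_compose[OF filterlim_floor_sequentially Lm]])
  have "filterlim (\<lambda>x. \<epsilon>\<^sup>2 * L x) at_top error_limit"
    using \<epsilon> by (intro filterlim_tendsto_pos_mult_at_top[OF tendsto_const _ L]) simp
  then have "((\<lambda>x. exp (- (\<epsilon>\<^sup>2 * L x))) \<longlongrightarrow> 0) error_limit"
    by (intro filterlim_compose[OF exp_at_bot]) (simp add: filterlim_uminus_at_top)
  then have "(p \<longlongrightarrow> 0 + 0 + 0) error_limit"
    unfolding p_def[abs_def] by (intro tendsto_add \<gamma> filterlim_compose[OF dev N])
  then have p: "(p \<longlongrightarrow> 0) error_limit" by simp
  have "\<forall>\<^sub>F x in error_limit. 1 \<le> N x"
    using N by (simp add: filterlim_at_top)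
  moreover have "\<forall>\<^sub>F x in error_limit. 0 < L x"
    using L by (simp add: filterlim_at_top_dense)
  ultimately have "\<forall>\<^sub>F x in error_limit.
    ennreal (((1 - \<epsilon>) * (L x / m)) powr q * (1 - p x))
      \<le> (case x of (\<alpha>, \<beta>) \<Rightarrow> INF (\<tau>, d)\<in>test_class K S P0 P1 \<F> \<alpha> \<beta>.
            \<integral>\<^sup>+\<omega>. enat_powr (\<tau> \<omega>) q \<partial>law A)"
    using eventually_error_limit_range
  proof (eventually_elim, clarify intro!: INF_greatest)
    fix \<alpha> \<beta> :: real and \<tau> d
    let ?x = "(\<alpha>, \<beta>)"
    assume Nx: "1 \<le> N ?x" and Lx: "0 < L ?x" and ab: "0 < \<alpha>" "\<alpha> < 1" "0 < \<beta>" "\<beta> < 1"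
      and test: "(\<tau>, d) \<in> test_class K S P0 P1 \<F> \<alpha> \<beta>"
    let ?y = "(1 - \<epsilon>) * (L ?x / m)"
    let ?E = "{\<omega> \<in> space (law A). \<tau> \<omega> \<le> enat (N ?x)}"
    have y: "0 \<le> ?y" using Lx m \<epsilon> by simp
    then have Ny: "real (N ?x) \<le> ?y" "?y \<le> real (Suc (N ?x))" unfolding N_def by linarith+
    have "(1 + \<epsilon>) * m * real (N ?x) \<le> (1 + \<epsilon>) * m * ?y"
      using Ny m \<epsilon> by (intro mult_left_mono) auto
    also have "\<dots> = (1 - \<epsilon>\<^sup>2) * L ?x" using m by (simp add: field_simps power2_eq_square)
    finally have c: "(1 + \<epsilon>) * m * real (N ?x) \<le> (1 - \<epsilon>\<^sup>2) * L ?x" .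
    have "measure (law A) ?E \<le> p ?x"
      using early[OF ab Nx c test] by (simp add: p_def space_law algebra_simps)
    then have "ennreal (?y powr q * (1 - p ?x)) \<le> ennreal (?y powr q * (1 - measure (law A) ?E))"
      by (intro ennreal_leI mult_left_mono) auto
    also have "\<dots> \<le> (\<integral>\<^sup>+\<omega>. enat_powr (\<tau> \<omega>) q \<partial>law A)"
    proof (rule nn_integral_enat_powr_ge[OF prob_space_law q y Ny(2)])
      have "(\<tau>, d) \<in> sequential_tests K S" using test by (simp add: test_class_def)
      from sets_law_filtration[OF sequential_test_events(2)[OF this]]
      show "?E \<in> sets (law A)" by (simp add: space_law)
    qed
    finally show "ennreal (?y powr q * (1 - p ?x)) \<le> (\<integral>\<^sup>+\<omega>. enat_powr (\<tau> \<omega>) q \<partial>law A)" .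
  qed
  with p show ?thesis by blast
qed

lemma gslrt_time_le:
  assumes "gslrt_stat K S P0 P1 \<F> t \<omega> \<notin> {-a<..<b}" "1 \<le> t"
  shows "gslrt_time K S P0 P1 \<F> a b \<omega> \<le> enat t"
  using assms unfolding gslrt_time_le_iff by blast

lemma llr_deviationD:
  assumes "\<omega> \<in> space (joint_space K S)" "\<omega> \<notin> llr_deviation I0 I1 \<F> A \<delta> t" "B \<in> \<F>"
  shows "\<bar>joint_llr K S P0 P1 B t \<omega> - real t * drift I0 I1 A B\<bar> \<le> \<delta> * real t"
  using assms by (force simp: llr_deviation_def)

end

theorem mainTheorem2:
  fixes K r :: nat
    and S :: "nat \<Rightarrow> 'a measure"
    and P0 P1 :: "nat \<Rightarrow> (nat \<Rightarrow> 'a) measure"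
    and \<F> :: "nat set set"
    and I0 I1 :: "nat \<Rightarrow> real"
    and q :: real
  assumes "multichannel_model K S P0 P1"
    and "\<F> \<subseteq> Pow {1..K}" and "\<F> \<noteq> {}" and "{} \<notin> \<F>"
    and "r \<ge> 1"
    and "\<And>k. k \<in> {1..K} \<Longrightarrow> I0 k > 0"
    and "\<And>k. k \<in> {1..K} \<Longrightarrow> I1 k > 0"
    and "\<And>k \<epsilon>. k \<in> {1..K} \<Longrightarrow> \<epsilon> > 0 \<Longrightarrow>
      (\<lambda>t. real t ^ (r - 1) *
         \<P>(x in P0 k. \<bar>channel_llr S P0 P1 k t x / real t + I0 k\<bar> > \<epsilon>)) summable_on {1..}"
    and "\<And>k \<epsilon>. k \<in> {1..K} \<Longrightarrow> \<epsilon> > 0 \<Longrightarrow>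
      (\<lambda>t. real t ^ (r - 1) *
         \<P>(x in P1 k. \<bar>channel_llr S P0 P1 k t x / real t - I1 k\<bar> > \<epsilon>)) summable_on {1..}"
    and "1 \<le> q" and "q \<le> real r"
  shows
    "ennreal_asymp_equiv
       (\<lambda>(\<alpha>, \<beta>). \<integral>\<^sup>+\<omega>. enat_powr
          (gslrt_time K S P0 P1 \<F> \<bar>ln \<beta>\<bar> \<bar>ln (\<alpha> / real (card \<F>))\<bar> \<omega>) q \<partial>global_null K P0)
       error_limit
       (\<lambda>(\<alpha>, \<beta>). ennreal ((\<bar>ln \<beta>\<bar> / (MIN A\<in>\<F>. \<Sum>k\<in>A. I0 k)) powr q)) \<and>
     ennreal_asymp_equiv
       (\<lambda>(\<alpha>, \<beta>). ennreal ((\<bar>ln \<beta>\<bar> / (MIN A\<in>\<F>. \<Sum>k\<in>A. I0 k)) powr q))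
       error_limit
       (\<lambda>(\<alpha>, \<beta>). INF (\<tau>, d)\<in>test_class K S P0 P1 \<F> \<alpha> \<beta>.
          \<integral>\<^sup>+\<omega>. enat_powr (\<tau> \<omega>) q \<partial>global_null K P0) \<and>
     (\<forall>A\<in>\<F>. ennreal_asymp_equiv
       (\<lambda>(\<alpha>, \<beta>). \<integral>\<^sup>+\<omega>. enat_powr
          (gslrt_time K S P0 P1 \<F> \<bar>ln \<beta>\<bar> \<bar>ln (\<alpha> / real (card \<F>))\<bar> \<omega>) q \<partial>signal_law K P0 P1 A)
       error_limit
       (\<lambda>(\<alpha>, \<beta>). ennreal ((\<bar>ln \<alpha>\<bar> / (\<Sum>k\<in>A. I1 k)) powr q))) \<and>
     (\<forall>A\<in>\<F>. ennreal_asymp_equiv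
       (\<lambda>(\<alpha>, \<beta>). ennreal ((\<bar>ln \<alpha>\<bar> / (\<Sum>k\<in>A. I1 k)) powr q))
       error_limit
       (\<lambda>(\<alpha>, \<beta>). INF (\<tau>, d)\<in>test_class K S P0 P1 \<F> \<alpha> \<beta>.
          \<integral>\<^sup>+\<omega>. enat_powr (\<tau> \<omega>) q \<partial>signal_law K P0 P1 A))"
proof -
  interpret multichannel_model K S P0 P1 by fact
  note F = \<open>\<F> \<subseteq> Pow {1..K}\<close> and nonempty = \<open>\<F> \<noteq> {}\<close> \<open>{} \<notin> \<F>\<close>
  note I0 = assms(6) and I1 = assms(7) and q = \<open>1 \<le> q\<close> \<open>q \<le> real r\<close>
  have fin: "finite \<F>" using F by (rule finite_subset) simp
  have card: "1 \<le> real (card \<F>)" using fin nonempty by (simp add: Suc_leI card_gt_0_iff)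
  let ?Z = "joint_llr K S P0 P1" and ?st = "gslrt_stat K S P0 P1 \<F>"
  let ?T = "\<lambda>\<alpha> \<beta>. gslrt_time K S P0 P1 \<F> \<bar>ln \<beta>\<bar> \<bar>ln (\<alpha> / real (card \<F>))\<bar>"
  let ?dev = "llr_deviation I0 I1 \<F>"
  have sub: "A \<subseteq> {1..K}" if "A \<in> \<F>" for A using that F by auto
  have dev: "summable (\<lambda>t. real t ^ (r - 1) * measure (law A) (?dev A \<delta> t))"
    if "A \<subseteq> {1..K}" "0 < \<delta>" for A \<delta>
    by (rule summable_llr_deviation[OF F that]) (fact assms(8) assms(9))+
  have dev0: "(\<lambda>t. measure (law A) (?dev A \<delta> t)) \<longlonglongrightarrow> 0" if "A \<subseteq> {1..K}" "0 < \<delta>" for A \<delta>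
    by (rule prob_space.complete_convergence_imp_in_prob[OF prob_space_law dev[OF that]])
  have INF_le: "\<forall>\<^sub>F x in error_limit.
      (case x of (\<alpha>, \<beta>) \<Rightarrow> INF (\<tau>, d)\<in>test_class K S P0 P1 \<F> \<alpha> \<beta>. \<integral>\<^sup>+\<omega>. enat_powr (\<tau> \<omega>) q \<partial>law A)
      \<le> (case x of (\<alpha>, \<beta>) \<Rightarrow> \<integral>\<^sup>+\<omega>. enat_powr (?T \<alpha> \<beta> \<omega>) q \<partial>law A)" for A
    using eventually_error_limit_range
    by eventually_elim (auto intro!: INF_lower2[OF gslrt_in_test_class[OF F nonempty(1)]])

  let ?m = "MIN A\<in>\<F>. \<Sum>k\<in>A. I0 k"
  \<comment> \<open>The pattern closest to the null: missing it is the error that binds a test under the null.\<close>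
  have "?m \<in> (\<lambda>A. \<Sum>k\<in>A. I0 k) ` \<F>" using fin nonempty by (intro Min_in) auto
  then obtain M where M: "M \<in> \<F>" "(\<Sum>k\<in>M. I0 k) = ?m" by auto
  have le_m: "?m \<le> (\<Sum>k\<in>A. I0 k)" if "A \<in> \<F>" for A using that fin by (intro Min_le) auto
  have pos0: "0 < (\<Sum>k\<in>A. I0 k)" and pos1: "0 < (\<Sum>k\<in>A. I1 k)" if A: "A \<in> \<F>" for A
  proof -
    have "finite A" "A \<noteq> {}" using sub[OF A] finite_subset A nonempty by auto
    then show "0 < (\<Sum>k\<in>A. I0 k)" "0 < (\<Sum>k\<in>A. I1 k)"
      using sub[OF A] I0 I1 by (auto intro!: sum_pos)
  qed
  have m: "0 < ?m" using pos0[OF M(1)] M(2) by simp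
  have drift0: "drift I0 I1 {} A = - (\<Sum>k\<in>A. I0 k)" for A by (simp add: drift_def sum_negf)
  have drift1: "drift I0 I1 A A = (\<Sum>k\<in>A. I1 k)" for A by (simp add: drift_def)

  have null: "ennreal_asymp_equiv (\<lambda>(\<alpha>, \<beta>). \<integral>\<^sup>+\<omega>. enat_powr (?T \<alpha> \<beta> \<omega>) q \<partial>law {})
       error_limit (\<lambda>x. ennreal (((\<lambda>(\<alpha>, \<beta>). \<bar>ln \<beta>\<bar>) x / ?m) powr q)) \<and>
     ennreal_asymp_equiv (\<lambda>x. ennreal (((\<lambda>(\<alpha>, \<beta>). \<bar>ln \<beta>\<bar>) x / ?m) powr q)) error_limit
       (\<lambda>(\<alpha>, \<beta>). INF (\<tau>, d)\<in>test_class K S P0 P1 \<F> \<alpha> \<beta>. \<integral>\<^sup>+\<omega>. enat_powr (\<tau> \<omega>) q \<partial>law {})"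
  proof (rule ennreal_asymp_equiv_sandwich[where c = 0,
        OF filterlim_abs_ln_error_limit(2) m q(1) _ _ INF_le])
    fix \<delta> assume \<delta>: "0 < \<delta>" "\<delta> < ?m"
    obtain C where C: "\<And>T h. 0 \<le> h \<Longrightarrow>
        (\<And>t \<omega>. \<omega> \<in> space (joint_space K S) \<Longrightarrow> 1 \<le> t \<Longrightarrow> h \<le> real t * (?m - \<delta>) \<Longrightarrow>
           \<omega> \<notin> ?dev {} \<delta> t \<Longrightarrow> T \<omega> \<le> enat t) \<Longrightarrow>
        (\<integral>\<^sup>+\<omega>. enat_powr (T \<omega>) q \<partial>law {}) \<le> ennreal ((h / (?m - \<delta>) + 2) powr q + C)"
      using nn_integral_stopping_time_le[OF fin q \<delta>(2) dev[OF _ \<delta>(1)]] by blast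
    have "(\<integral>\<^sup>+\<omega>. enat_powr (?T \<alpha> \<beta> \<omega>) q \<partial>law {}) \<le> ennreal ((\<bar>ln \<beta>\<bar> / (?m - \<delta>) + 2) powr q + C)" for \<alpha> \<beta>
    proof (rule C)
      fix t \<omega> assume \<omega>: "\<omega> \<in> space (joint_space K S)" "\<omega> \<notin> ?dev {} \<delta> t" and t: "1 \<le> t"
        and h: "\<bar>ln \<beta>\<bar> \<le> real t * (?m - \<delta>)"
      have "?Z B t \<omega> \<le> - \<bar>ln \<beta>\<bar>" if B: "B \<in> \<F>" for B
      proof -
        have "?Z B t \<omega> \<le> \<delta> * real t - real t * (\<Sum>k\<in>B. I0 k)"
          using llr_deviationD[OF \<omega> B] by (simp add: drift0)
        also have "\<dots> \<le> \<delta> * real t - real t * ?m" using le_m[OF B] by (intro diff_left_mono mult_left_mono) auto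
        also have "\<dots> \<le> - \<bar>ln \<beta>\<bar>" using h by (simp add: algebra_simps)
        finally show ?thesis .
      qed
      then have "?st t \<omega> \<le> - \<bar>ln \<beta>\<bar>"
        unfolding gslrt_stat_def using fin nonempty by (subst Max_le_iff) auto
      then show "?T \<alpha> \<beta> \<omega> \<le> enat t" by (intro gslrt_time_le t) auto
    qed simp
    then show "\<exists>C. \<forall>\<^sub>F x in error_limit. (case x of (\<alpha>, \<beta>) \<Rightarrow> \<integral>\<^sup>+\<omega>. enat_powr (?T \<alpha> \<beta> \<omega>) q \<partial>law {})
        \<le> ennreal ((((case x of (\<alpha>, \<beta>) \<Rightarrow> \<bar>ln \<beta>\<bar>) + 0) / (?m - \<delta>) + 2) powr q + C)"
      by (intro exI[of _ C] always_eventually) auto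
  next
    fix \<epsilon> :: real assume \<epsilon>: "0 < \<epsilon>" "\<epsilon> < 1"
    show "\<exists>p. (p \<longlongrightarrow> 0) error_limit \<and> (\<forall>\<^sub>F x in error_limit.
      ennreal (((1 - \<epsilon>) * ((case x of (\<alpha>, \<beta>) \<Rightarrow> \<bar>ln \<beta>\<bar>) / ?m)) powr q * (1 - p x))
        \<le> (case x of (\<alpha>, \<beta>) \<Rightarrow> INF (\<tau>, d)\<in>test_class K S P0 P1 \<F> \<alpha> \<beta>.
              \<integral>\<^sup>+\<omega>. enat_powr (\<tau> \<omega>) q \<partial>law {}))"
    proof (rule nn_integral_test_class_ge[OF _ m \<epsilon> dev0 filterlim_abs_ln_error_limit(2) error_limit_tendsto_0(1)])
      fix \<alpha> \<beta> c \<tau> d and N :: nat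
      assume ab: "0 < \<alpha>" "\<alpha> < 1" "0 < \<beta>" "\<beta> < 1" and N: "1 \<le> N" and c: "(1 + \<epsilon>) * ?m * real N \<le> c"
        and test: "(\<tau>, d) \<in> test_class K S P0 P1 \<F> \<alpha> \<beta>"
      have "{\<omega> \<in> space (joint_space K S). ?Z M N \<omega> < - c} \<subseteq> ?dev {} (\<epsilon> * ?m) N"
      proof clarify
        fix \<omega> assume \<omega>: "\<omega> \<in> space (joint_space K S)" and less: "?Z M N \<omega> < - c"
        show "\<omega> \<in> ?dev {} (\<epsilon> * ?m) N"
        proof (rule ccontr)
          assume "\<omega> \<notin> ?dev {} (\<epsilon> * ?m) N"
          from llr_deviationD[OF \<omega> this M(1)] less c show False
            by (simp add: drift0 M(2) algebra_simps)
        qed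
      qed
      then have "measure (law {}) {\<omega> \<in> space (joint_space K S). ?Z M N \<omega> < - c}
          \<le> measure (law {}) (?dev {} (\<epsilon> * ?m) N)"
        by (intro finite_measure.finite_measure_mono prob_space.finite_measure prob_space_law
            sets_llr_deviation fin)
      moreover have "exp c * \<beta> = exp (c - \<bar>ln \<beta>\<bar>)"
        using ab by (simp add: exp_add)
      ultimately show "measure (law {}) {\<omega> \<in> space (joint_space K S). \<tau> \<omega> \<le> enat N}
          \<le> (case (\<alpha>, \<beta>) of (\<alpha>, \<beta>) \<Rightarrow> \<alpha>) + exp (c - (case (\<alpha>, \<beta>) of (\<alpha>, \<beta>) \<Rightarrow> \<bar>ln \<beta>\<bar>))
            + measure (law {}) (?dev {} (\<epsilon> * ?m) N)"
        using test_class_early_stopping(1)[OF F M(1) N test, of c] by simp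
    qed (use \<epsilon> m q in auto)
  qed

  have signal: "ennreal_asymp_equiv (\<lambda>(\<alpha>, \<beta>). \<integral>\<^sup>+\<omega>. enat_powr (?T \<alpha> \<beta> \<omega>) q \<partial>law A)
       error_limit (\<lambda>x. ennreal (((\<lambda>(\<alpha>, \<beta>). \<bar>ln \<alpha>\<bar>) x / (\<Sum>k\<in>A. I1 k)) powr q)) \<and>
     ennreal_asymp_equiv (\<lambda>x. ennreal (((\<lambda>(\<alpha>, \<beta>). \<bar>ln \<alpha>\<bar>) x / (\<Sum>k\<in>A. I1 k)) powr q)) error_limit
       (\<lambda>(\<alpha>, \<beta>). INF (\<tau>, d)\<in>test_class K S P0 P1 \<F> \<alpha> \<beta>. \<integral>\<^sup>+\<omega>. enat_powr (\<tau> \<omega>) q \<partial>law A)"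
    if A: "A \<in> \<F>" for A
  proof (rule ennreal_asymp_equiv_sandwich[where c = "ln (real (card \<F>))",
        OF filterlim_abs_ln_error_limit(1) pos1[OF A] q(1) _ _ INF_le])
    let ?I = "\<Sum>k\<in>A. I1 k"
    fix \<delta> assume \<delta>: "0 < \<delta>" "\<delta> < ?I"
    obtain C where C: "\<And>T h. 0 \<le> h \<Longrightarrow>
        (\<And>t \<omega>. \<omega> \<in> space (joint_space K S) \<Longrightarrow> 1 \<le> t \<Longrightarrow> h \<le> real t * (?I - \<delta>) \<Longrightarrow>
           \<omega> \<notin> ?dev A \<delta> t \<Longrightarrow> T \<omega> \<le> enat t) \<Longrightarrow>
        (\<integral>\<^sup>+\<omega>. enat_powr (T \<omega>) q \<partial>law A) \<le> ennreal ((h / (?I - \<delta>) + 2) powr q + C)"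
      using nn_integral_stopping_time_le[OF fin q \<delta>(2) dev[OF sub[OF A] \<delta>(1)]] by blast
    have bound: "(\<integral>\<^sup>+\<omega>. enat_powr (?T \<alpha> \<beta> \<omega>) q \<partial>law A)
        \<le> ennreal ((\<bar>ln (\<alpha> / real (card \<F>))\<bar> / (?I - \<delta>) + 2) powr q + C)" for \<alpha> \<beta>
    proof (rule C)
      fix t \<omega> assume \<omega>: "\<omega> \<in> space (joint_space K S)" "\<omega> \<notin> ?dev A \<delta> t" and t: "1 \<le> t"
        and h: "\<bar>ln (\<alpha> / real (card \<F>))\<bar> \<le> real t * (?I - \<delta>)"
      have "\<bar>ln (\<alpha> / real (card \<F>))\<bar> \<le> ?Z A t \<omega>"
        using llr_deviationD[OF \<omega> A] h by (simp add: drift1 algebra_simps)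
      also have "?Z A t \<omega> \<le> ?st t \<omega>"
        unfolding gslrt_stat_def using fin A by (intro Max_ge) auto
      finally show "?T \<alpha> \<beta> \<omega> \<le> enat t" by (intro gslrt_time_le t) auto
    qed simp
    have ln_card: "\<bar>ln (\<alpha> / real (card \<F>))\<bar> = \<bar>ln \<alpha>\<bar> + ln (real (card \<F>))" if "0 < \<alpha>" "\<alpha> < 1" for \<alpha>
      using that card by (simp add: ln_div)
    show "\<exists>C. \<forall>\<^sub>F x in error_limit. (case x of (\<alpha>, \<beta>) \<Rightarrow> \<integral>\<^sup>+\<omega>. enat_powr (?T \<alpha> \<beta> \<omega>) q \<partial>law A)
        \<le> ennreal ((((case x of (\<alpha>, \<beta>) \<Rightarrow> \<bar>ln \<alpha>\<bar>) + ln (real (card \<F>))) / (?I - \<delta>) + 2) powr q + C)"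
      using eventually_error_limit_range
    proof (intro exI[of _ C], eventually_elim)
      case (elim x)
      obtain \<alpha> \<beta> where "x = (\<alpha>, \<beta>)" by (cases x)
      with elim bound[of \<beta> \<alpha>] ln_card[of \<alpha>] show ?case by simp
    qed
  next
    let ?I = "\<Sum>k\<in>A. I1 k"
    fix \<epsilon> :: real assume \<epsilon>: "0 < \<epsilon>" "\<epsilon> < 1"
    show "\<exists>p. (p \<longlongrightarrow> 0) error_limit \<and> (\<forall>\<^sub>F x in error_limit.
      ennreal (((1 - \<epsilon>) * ((case x of (\<alpha>, \<beta>) \<Rightarrow> \<bar>ln \<alpha>\<bar>) / ?I)) powr q * (1 - p x))
        \<le> (case x of (\<alpha>, \<beta>) \<Rightarrow> INF (\<tau>, d)\<in>test_class K S P0 P1 \<F> \<alpha> \<beta>.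
              \<integral>\<^sup>+\<omega>. enat_powr (\<tau> \<omega>) q \<partial>law A))"
    proof (rule nn_integral_test_class_ge[OF _ pos1[OF A] \<epsilon> dev0 filterlim_abs_ln_error_limit(1) error_limit_tendsto_0(2)])
      fix \<alpha> \<beta> c \<tau> d and N :: nat
      assume ab: "0 < \<alpha>" "\<alpha> < 1" "0 < \<beta>" "\<beta> < 1" and N: "1 \<le> N" and c: "(1 + \<epsilon>) * ?I * real N \<le> c"
        and test: "(\<tau>, d) \<in> test_class K S P0 P1 \<F> \<alpha> \<beta>"
      have "{\<omega> \<in> space (joint_space K S). c < ?Z A N \<omega>} \<subseteq> ?dev A (\<epsilon> * ?I) N"
      proof clarify
        fix \<omega> assume \<omega>: "\<omega> \<in> space (joint_space K S)" and less: "c < ?Z A N \<omega>"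
        show "\<omega> \<in> ?dev A (\<epsilon> * ?I) N"
        proof (rule ccontr)
          assume "\<omega> \<notin> ?dev A (\<epsilon> * ?I) N"
          from llr_deviationD[OF \<omega> this A] less c show False
            by (simp add: drift1 algebra_simps)
        qed
      qed
      then have "measure (law A) {\<omega> \<in> space (joint_space K S). c < ?Z A N \<omega>}
          \<le> measure (law A) (?dev A (\<epsilon> * ?I) N)"
        by (intro finite_measure.finite_measure_mono prob_space.finite_measure prob_space_law
            sets_llr_deviation fin)
      moreover have "exp c * \<alpha> = exp (c - \<bar>ln \<alpha>\<bar>)"
        using ab by (simp add: exp_add)
      ultimately show "measure (law A) {\<omega> \<in> space (joint_space K S). \<tau> \<omega> \<le> enat N}
          \<le> (case (\<alpha>, \<beta>) of (\<alpha>, \<beta>) \<Rightarrow> \<beta>) + exp (c - (case (\<alpha>, \<beta>) of (\<alpha>, \<beta>) \<Rightarrow> \<bar>ln \<alpha>\<bar>))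
            + measure (law A) (?dev A (\<epsilon> * ?I) N)"
        using test_class_early_stopping(2)[OF F A N test, of c] by simp
    qed (use \<epsilon> pos1[OF A] q sub[OF A] in auto)
  qed

  have eq: "(\<lambda>(\<alpha>, \<beta>). ennreal ((\<bar>ln \<alpha>\<bar> / i) powr q)) = (\<lambda>x. ennreal (((\<lambda>(\<alpha>, \<beta>). \<bar>ln \<alpha>\<bar>) x / i) powr q))"
    "(\<lambda>(\<alpha>, \<beta>). ennreal ((\<bar>ln \<beta>\<bar> / i) powr q)) = (\<lambda>x. ennreal (((\<lambda>(\<alpha>, \<beta>). \<bar>ln \<beta>\<bar>) x / i) powr q))"
    for i :: real by (auto simp: fun_eq_iff)
  show ?thesis
    unfolding eq global_null_eq_law using null signal by blast
qed

end
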